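(* Let $(G_n)_{n\geq 0}$ be an expander (in the sense defined in the context). For any $c\in\,]0,1[$, there exists a sequence $(p^*_n(c))_{n\ge 0}$ of numbers in $[0,1]$, bounded away from zero and one (i.e. there exist $0<a<a'<1$ with $p^*_n(c)\in[a,a']$ for all $n$), such that for every $\varepsilon>0$ and every sequence $(p_n)_{n\ge0}$ in $[0,1]$: (i) if $p_n \geq p^*_n(c)+\varepsilon$ for all $n$, then \[ \lim_{n\to \infty}\mathbb{P}\big(G_n(p_n) \text{ contains a connected component with at least } c|V_n| \text{ vertices}\big) = 1; \] (ii) if $p_n \leq p^*_n(c)-\varepsilon$ for all $n$, then \[ \lim_{n\to \infty}\mathbb{P}\big(G_n(p_n) \text{ contains a connected component with at least } c|V_n| \text{ vertices}\big) = 0. \]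
   Context: For a finite graph $G=(V,E)$ and sets of vertices $A,B$, $E(A,B)$ denotes the set of edges with one endpoint in $A$ and the other in $B$. The Cheeger constant (edge-isoperimetric number) of $G$ is $c(G)=\min_{A\subset V,\,0<|A|\le |V|/2} |E(A,A^c)|/|A|$. An expander is a sequence of finite graphs $G_n=(V_n,E_n)$ for which there are constants $b>0$ and $d\in\mathbb{N}^*$ such that for every $n$ the maximal degree of $G_n$ is at most $d$ and $c(G_n)>b$, and moreover $|V_n|\to\infty$ as $n\to\infty$. For $p\in[0,1]$, $G(p)$ denotes the random spanning subgraph of $G$ obtained by retaining each edge of $G$ independently with probability $p$. *)

theory Defs
  imports "HOL-Analysis.Analysis"
begin

definition finite_graph :: "'a set \<Rightarrow> 'a set set \<Rightarrow> bool" where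
  "finite_graph V E \<longleftrightarrow> finite V \<and> (\<forall>e\<in>E. e \<subseteq> V \<and> card e = 2)"

definition degree :: "'a set set \<Rightarrow> 'a \<Rightarrow> nat" where
  "degree E v = card {e \<in> E. v \<in> e}"

definition edge_boundary :: "'a set \<Rightarrow> 'a set set \<Rightarrow> 'a set \<Rightarrow> 'a set set" where
  "edge_boundary V E A = {e \<in> E. e \<inter> A \<noteq> {} \<and> e \<inter> (V - A) \<noteq> {}}"

text \<open>Cheeger constant c(G) > b, i.e. the minimum of |E(A,A^c)|/|A| over
  0 < |A| <= |V|/2 exceeds b (unfolded: every such quotient exceeds b).\<close>
definition cheeger_gt :: "'a set \<Rightarrow> 'a set set \<Rightarrow> real \<Rightarrow> bool" where
  "cheeger_gt V E b \<longleftrightarrow>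
     (\<forall>A. A \<subseteq> V \<and> 0 < card A \<and> real (card A) \<le> real (card V) / 2 \<longrightarrow>
          real (card (edge_boundary V E A)) / real (card A) > b)"

definition expander :: "(nat \<Rightarrow> 'a set) \<Rightarrow> (nat \<Rightarrow> 'a set set) \<Rightarrow> bool" where
  "expander V E \<longleftrightarrow>
     (\<forall>n. finite_graph (V n) (E n)) \<and>
     (\<exists>(b::real) (d::nat). b > 0 \<and> d \<ge> 1 \<and>
        (\<forall>n. (\<forall>v\<in>V n. degree (E n) v \<le> d) \<and> cheeger_gt (V n) (E n) b)) \<and>
     filterlim (\<lambda>n. card (V n)) at_top sequentially"

definition component :: "'a set \<Rightarrow> 'a set set \<Rightarrow> 'a \<Rightarrow> 'a set" where
  "component V F v = {w \<in> V. (\<lambda>x y. {x, y} \<in> F)\<^sup>*\<^sup>* v w}"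

definition has_large_component :: "'a set \<Rightarrow> 'a set set \<Rightarrow> real \<Rightarrow> bool" where
  "has_large_component V F c \<longleftrightarrow> (\<exists>v\<in>V. real (card (component V F v)) \<ge> c * real (card V))"

text \<open>Probability of event P for the random spanning subgraph G(p): each edge
  retained independently with probability p.\<close>
definition perc_prob :: "'a set set \<Rightarrow> real \<Rightarrow> ('a set set \<Rightarrow> bool) \<Rightarrow> real" where
  "perc_prob E p P = (\<Sum>F\<in>{F. F \<subseteq> E \<and> P F}. p ^ card F * (1 - p) ^ (card E - card F))"

end

theory Submission
  imports Defs
begin

text \<open>
  Let \<open>n\<close> be the number of vertices, and let \<open>X\<close> be the sum of the squared component
  sizes divided by \<open>n\<^sup>2\<close>. Opening an edge between distinct components \<open>C\<^sub>1\<close>, \<open>C\<^sub>2\<close>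
  increases \<open>X\<close> by \<open>2 |C\<^sub>1| |C\<^sub>2| / n\<^sup>2\<close>. Since \<open>0 \<le> X \<le> 1\<close>, by Russo's formula every
  interval of length \<open>\<eta>\<close> contains a good \<open>p\<close>, at which these increases have expected sum at
  most \<open>1 / \<eta>\<close>.

  At a good \<open>p\<close> the variable \<open>X\<close> is concentrated. The inequality
  \<open>Var f \<le> 2 E |\<nabla>f|\<close> (of Margulis and Bobkov type, proved by induction on the edges) reduces
  this to bounding \<open>E (N\<^sup>1\<^sup>/\<^sup>2)\<close>, where \<open>N\<close> is the number of closed edges joining two
  distinct components of size at least \<open>\<alpha> n\<close>. Goodness gives \<open>E N = O(1)\<close>. If two such
  components exist, then by expansion linearly many vertices of one are at bounded distance
  from the other; opening the edges of a short path one at a time (finite energy) gives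
  \<open>n P(N > 0) = O(E N)\<close>, and Cauchy-Schwarz yields \<open>E (N\<^sup>1\<^sup>/\<^sup>2) = O(n\<^sup>-\<^sup>1\<^sup>/\<^sup>2)\<close>.

  If the probability of a component of size \<open>c n\<close> stayed in \<open>[\<delta>, 1 - \<delta>]\<close> on an interval of
  length \<open>\<epsilon>\<close>, then \<open>E X\<close> would be close to \<open>c\<^sup>2\<close> at good points near both ends. But the
  Cheeger bound makes the increases of \<open>X\<close> sum to at least \<open>b (1 - c) X\<close> whenever there is no
  such component, so \<open>E X\<close> grows by a fixed amount in between: a contradiction.
\<close>

section \<open>Product Bernoulli measures\<close>

text \<open>A polynomial in \<open>p\<close>, defined for every real \<open>p\<close>, so that it
  can be differentiated at 0 and 1 as well. For \<open>p\<close> in [0,1] it is the expectation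
  under independent retention of edges.\<close>

definition expect :: "'b set \<Rightarrow> real \<Rightarrow> ('b set \<Rightarrow> real) \<Rightarrow> real" where
  "expect E p f = (\<Sum>F\<in>Pow E. p ^ card F * (1 - p) ^ (card E - card F) * f F)"

lemma expect_empty [simp]: "expect {} p f = f {}"
  by (simp add: expect_def)

text \<open>Conditioning on the state of one edge. This recursion drives the inductions over the
  edge set.\<close>

lemma expect_insert:
  assumes "finite E" "e \<notin> E"
  shows "expect (insert e E) p f =
           p * expect E p (\<lambda>F. f (insert e F)) + (1 - p) * expect E p f"
proof -
  have inj: "inj_on (insert e) (Pow E)"
    using assms(2) by (auto simp: inj_on_def)
  have disj: "Pow E \<inter> insert e ` Pow E = {}"
    using assms(2) by auto
  have fin: "finite F" "card F \<le> card E" "e \<notin> F" if "F \<in> Pow E" for F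
    using that assms by (auto intro: finite_subset card_mono)
  show ?thesis
    unfolding expect_def Pow_insert
    using assms(1) disj
    by (subst sum.union_disjoint)
      (auto simp: sum.reindex[OF inj] sum_distrib_left fin assms Suc_diff_le mult_ac
        intro!: sum.cong)
qed

lemma expect_remove:
  assumes "finite E" "e \<in> E"
  shows "expect E p f =
           p * expect (E - {e}) p (\<lambda>F. f (insert e F)) + (1 - p) * expect (E - {e}) p f"
  using expect_insert[of "E - {e}" e p f] assms by (simp add: insert_absorb)

lemma expect_add: "expect E p (\<lambda>F. f F + g F) = expect E p f + expect E p g"
  by (simp add: expect_def algebra_simps sum.distrib)

lemma expect_diff: "expect E p (\<lambda>F. f F - g F) = expect E p f - expect E p g"
  by (simp add: expect_def algebra_simps sum_subtractf)

lemma expect_cmult: "expect E p (\<lambda>F. k * f F) = k * expect E p f"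
  by (simp add: expect_def sum_distrib_left mult_ac)

lemma expect_sum: "expect E p (\<lambda>F. \<Sum>i\<in>I. f i F) = (\<Sum>i\<in>I. expect E p (f i))"
  unfolding expect_def sum_distrib_left by (rule sum.swap)

lemma expect_const: "finite E \<Longrightarrow> expect E p (\<lambda>_. k) = k"
  by (induction E rule: finite_induct) (auto simp: expect_insert algebra_simps)

lemma expect_cong: "(\<And>F. F \<subseteq> E \<Longrightarrow> f F = g F) \<Longrightarrow> expect E p f = expect E p g"
  by (auto simp: expect_def intro!: sum.cong)

lemma expect_mono:
  assumes "0 \<le> p" "p \<le> 1" "\<And>F. F \<subseteq> E \<Longrightarrow> f F \<le> g F"
  shows "expect E p f \<le> expect E p g"
  using assms by (auto simp: expect_def intro!: sum_mono mult_left_mono)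

lemma expect_nonneg:
  assumes "0 \<le> p" "p \<le> 1" "\<And>F. F \<subseteq> E \<Longrightarrow> 0 \<le> f F"
  shows "0 \<le> expect E p f"
  using assms by (auto simp: expect_def intro!: sum_nonneg)

text \<open>First-moment principle. Applied to indicators, it extracts one configuration that has
  several properties at once.\<close>

lemma expect_witness:
  assumes "0 \<le> p" "p \<le> 1" "expect E p g < expect E p f"
  obtains F where "F \<subseteq> E" "g F < f F"
  using expect_mono[OF assms(1,2), of E f g] assms(3) by (meson not_le)

lemma perc_prob_expect:
  assumes "finite E"
  shows "perc_prob E p P = expect E p (\<lambda>F. of_bool (P F))"
proof -
  have "expect E p (\<lambda>F. of_bool (P F)) =
      (\<Sum>F\<in>Pow E. if P F then p ^ card F * (1 - p) ^ (card E - card F) else 0)"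
    unfolding expect_def by (intro sum.cong) auto
  also have "\<dots> = (\<Sum>F\<in>{F\<in>Pow E. P F}. p ^ card F * (1 - p) ^ (card E - card F))"
    using assms by (subst sum.inter_filter) auto
  also have "{F\<in>Pow E. P F} = {F. F \<subseteq> E \<and> P F}"
    by auto
  finally show ?thesis
    by (simp add: perc_prob_def)
qed

text \<open>The triangle inequality for the weighted mean of the plane vectors
  \<open>(u F, v F)\<close>, realised as complex numbers. It carries the Euclidean norm through the
  induction for the isoperimetric inequality.\<close>

lemma expect_sqrt_sum_squares:
  assumes "0 \<le> p" "p \<le> 1"
  shows "sqrt ((expect E p u)\<^sup>2 + (expect E p v)\<^sup>2) \<le> expect E p (\<lambda>F. sqrt ((u F)\<^sup>2 + (v F)\<^sup>2))"
proof -
  define w where "w F = p ^ card F * (1 - p) ^ (card E - card F)" for F :: "'a set"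
  have w: "w F \<ge> 0" for F
    using assms by (simp add: w_def)
  have "norm (\<Sum>F\<in>Pow E. w F *\<^sub>R Complex (u F) (v F)) \<le>
      (\<Sum>F\<in>Pow E. norm (w F *\<^sub>R Complex (u F) (v F)))"
    by (rule norm_sum)
  also have "\<dots> = expect E p (\<lambda>F. sqrt ((u F)\<^sup>2 + (v F)\<^sup>2))"
  proof -
    have "sqrt ((w F * u F)\<^sup>2 + (w F * v F)\<^sup>2) = w F * sqrt ((u F)\<^sup>2 + (v F)\<^sup>2)" for F
      using w[of F] by (simp add: power_mult_distrib real_sqrt_mult flip: distrib_left)
    then show ?thesis
      unfolding expect_def w_def[symmetric] by (simp add: cmod_def)
  qed
  finally show ?thesis
    unfolding expect_def by (simp add: cmod_def w_def)
qed

lemma expect_square_le: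
  assumes "finite E" "0 \<le> p" "p \<le> 1"
  shows "(expect E p f)\<^sup>2 \<le> expect E p (\<lambda>F. (f F)\<^sup>2)"
proof -
  define m where "m = expect E p f"
  have "0 \<le> expect E p (\<lambda>F. (f F - m)\<^sup>2)"
    using assms by (intro expect_nonneg) auto
  also have "(\<lambda>F. (f F - m)\<^sup>2) = (\<lambda>F. ((f F)\<^sup>2 - 2 * m * f F) + m\<^sup>2)"
    by (auto simp: power2_eq_square algebra_simps)
  also have "expect E p \<dots> = expect E p (\<lambda>F. (f F)\<^sup>2) - 2 * m * m + m\<^sup>2"
    by (simp add: expect_add expect_diff expect_cmult[of E p "2 * m"] expect_const[OF assms(1)])
      (simp add: m_def)
  finally show ?thesis
    by (simp add: m_def power2_eq_square)
qed

lemma expect_sqrt_le: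
  assumes "finite E" "0 \<le> p" "p \<le> 1" "\<And>F. F \<subseteq> E \<Longrightarrow> 0 \<le> f F"
  shows "expect E p (\<lambda>F. sqrt (f F)) \<le> sqrt (expect E p f)"
proof (rule real_le_rsqrt)
  have "(expect E p (\<lambda>F. sqrt (f F)))\<^sup>2 \<le> expect E p (\<lambda>F. (sqrt (f F))\<^sup>2)"
    by (rule expect_square_le) fact+
  also have "\<dots> = expect E p f"
    using assms(4) by (intro expect_cong) auto
  finally show "(expect E p (\<lambda>F. sqrt (f F)))\<^sup>2 \<le> expect E p f" .
qed

lemma expect_Markov:
  assumes "0 \<le> p" "p \<le> 1" "0 < k" "\<And>F. F \<subseteq> E \<Longrightarrow> 0 \<le> f F"
    and "\<And>F. F \<subseteq> E \<Longrightarrow> P F \<Longrightarrow> k \<le> f F"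
  shows "expect E p (\<lambda>F. of_bool (P F)) \<le> expect E p f / k"
proof -
  have "k * expect E p (\<lambda>F. of_bool (P F)) = expect E p (\<lambda>F. k * of_bool (P F))"
    by (simp add: expect_cmult)
  also have "\<dots> \<le> expect E p f"
    using assms by (intro expect_mono) auto
  finally show ?thesis
    using assms(3) by (simp add: field_simps)
qed

text \<open>The function \<open>sqrt (f F)\<close> equals its product with the indicator of
  \<open>f F \<noteq> 0\<close>; the bound is strong when \<open>f\<close> is rarely
  nonzero.\<close>

lemma expect_Cauchy_Schwarz:
  assumes "0 \<le> p" "p \<le> 1" "\<And>F. F \<subseteq> E \<Longrightarrow> 0 \<le> f F"
  shows "expect E p (\<lambda>F. sqrt (f F)) \<le>
    sqrt (expect E p (\<lambda>F. of_bool (f F \<noteq> 0)) * expect E p f)"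
proof -
  define w where "w F = p ^ card F * (1 - p) ^ (card E - card F)" for F :: "'a set"
  have w: "w F \<ge> 0" for F
    using assms by (simp add: w_def)
  have "expect E p (\<lambda>F. sqrt (f F)) =
      (\<Sum>F\<in>Pow E. sqrt (w F * of_bool (f F \<noteq> 0)) * sqrt (w F * f F))"
    unfolding expect_def w_def[symmetric]
    using w by (intro sum.cong) (auto simp: real_sqrt_mult)
  also have "\<dots> \<le> sqrt ((\<Sum>F\<in>Pow E. (sqrt (w F * of_bool (f F \<noteq> 0)))\<^sup>2) *
      (\<Sum>F\<in>Pow E. (sqrt (w F * f F))\<^sup>2))"
    using Cauchy_Schwarz_ineq_sum[of "\<lambda>F. sqrt (w F * of_bool (f F \<noteq> 0))" "\<lambda>F. sqrt (w F * f F)" "Pow E"]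
    by (intro real_le_rsqrt)
  also have "(\<Sum>F\<in>Pow E. (sqrt (w F * of_bool (f F \<noteq> 0)))\<^sup>2) = expect E p (\<lambda>F. of_bool (f F \<noteq> 0))"
    unfolding expect_def w_def[symmetric] using w by (intro sum.cong) auto
  also have "(\<Sum>F\<in>Pow E. (sqrt (w F * f F))\<^sup>2) = expect E p f"
    unfolding expect_def w_def[symmetric] using w assms(3) by (intro sum.cong) auto
  finally show ?thesis .
qed

section \<open>The variance is bounded by a one-sided gradient\<close>

text \<open>The case of one edge, with value \<open>a\<close> when open and \<open>b\<close> when
  closed. The concavity defect of \<Phi> is p(1-p)(a-b)^2/2, and the square root in the closed term
  alone absorbs it, because \<Phi> is at most 1/8 and |a-b| at most 1.\<close>

lemma two_point_inequality:
  fixes a b p :: real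
  assumes "0 \<le> p" "p \<le> 1" "0 \<le> a" "a \<le> 1" "0 \<le> b" "b \<le> 1"
  defines "\<Phi> \<equiv> \<lambda>x::real. x * (1 - x) / 2"
  shows "\<Phi> (p * a + (1 - p) * b) \<le> p * \<Phi> a + (1 - p) * sqrt ((\<Phi> b)\<^sup>2 + (a - b)\<^sup>2)"
proof -
  define t where "t = (a - b)\<^sup>2"
  have t: "0 \<le> t" "t \<le> 1"
  proof -
    have "\<bar>a - b\<bar> \<le> 1" using assms by linarith
    then show "t \<le> 1" by (simp add: t_def abs_square_le_1)
  qed (simp add: t_def)
  have \<Phi>b: "0 \<le> \<Phi> b" "\<Phi> b \<le> 1 / 8"
  proof -
    show "0 \<le> \<Phi> b" using assms by (simp add: \<Phi>_def)
    have "0 \<le> (b - 1 / 2)\<^sup>2" by simp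
    then show "\<Phi> b \<le> 1 / 8" by (simp add: \<Phi>_def power2_eq_square field_simps)
  qed
  have "\<Phi> b + t / 2 \<le> sqrt ((\<Phi> b)\<^sup>2 + t)"
  proof (rule real_le_rsqrt)
    have "\<Phi> b * t \<le> 1 / 8 * t" "t * t \<le> 1 * t"
      using \<Phi>b t by (intro mult_right_mono; simp)+
    then show "(\<Phi> b + t / 2)\<^sup>2 \<le> (\<Phi> b)\<^sup>2 + t"
      using t by (simp add: power2_eq_square algebra_simps)
  qed
  then have "(1 - p) * (\<Phi> b + t / 2) \<le> (1 - p) * sqrt ((\<Phi> b)\<^sup>2 + (a - b)\<^sup>2)"
    using assms by (intro mult_left_mono) (auto simp: t_def)
  moreover have "\<Phi> (p * a + (1 - p) * b) = p * \<Phi> a + (1 - p) * \<Phi> b + p * (1 - p) * t / 2"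
    by (simp add: \<Phi>_def t_def power2_eq_square field_simps)
  moreover have "p * ((1 - p) * t) \<le> 1 * ((1 - p) * t)"
    using assms t by (intro mult_right_mono) auto
  ultimately show ?thesis
    by (simp add: distrib_left)
qed

text \<open>
  The gradient is one-sided: only edges closed in \<open>F\<close> contribute. Hence a large contribution
  of an edge exhibits two big components of \<open>F\<close> itself, rather than of \<open>F - {e}\<close>.
\<close>

lemma isoperimetric_inequality:
  fixes f :: "'b set \<Rightarrow> real"
  assumes "finite E" "0 \<le> p" "p \<le> 1" "\<And>F. F \<subseteq> E \<Longrightarrow> 0 \<le> f F \<and> f F \<le> 1"
  defines "\<Phi> \<equiv> \<lambda>x::real. x * (1 - x) / 2"
  shows "\<Phi> (expect E p f) \<le>
    expect E p (\<lambda>F. sqrt ((\<Phi> (f F))\<^sup>2 + (\<Sum>e\<in>E - F. (f (insert e F) - f F)\<^sup>2)))"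
  using assms(1,4)
proof (induction E arbitrary: f rule: finite_induct)
  case empty
  then show ?case by (simp add: \<Phi>_def)
next
  case (insert e E)
  let ?G = "\<lambda>E f F. (\<Sum>e\<in>E - F. (f (insert e F) - f F)\<^sup>2)"
  define f1 where "f1 F = f (insert e F)" for F
  have f1: "0 \<le> f1 F \<and> f1 F \<le> 1" if "F \<subseteq> E" for F
    using that insert.prems[of "insert e F"] by (auto simp: f1_def)
  have f0: "0 \<le> f F \<and> f F \<le> 1" if "F \<subseteq> E" for F
    using that insert.prems[of F] by auto
  define a where "a = expect E p f1"
  define b where "b = expect E p f"
  have range: "0 \<le> expect E p h \<and> expect E p h \<le> 1"
    if "\<And>F. F \<subseteq> E \<Longrightarrow> 0 \<le> h F \<and> h F \<le> 1" for h
    using expect_nonneg[OF assms(2,3), of E h] expect_mono[OF assms(2,3), of E h "\<lambda>_. 1"] that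
    by (simp add: expect_const insert.hyps)
  have ab: "0 \<le> a" "a \<le> 1" "0 \<le> b" "b \<le> 1"
    using range f1 f0 by (auto simp: a_def b_def)
  have IH1: "\<Phi> a \<le> expect E p (\<lambda>F. sqrt ((\<Phi> (f1 F))\<^sup>2 + ?G E f1 F))"
    unfolding a_def by (rule insert.IH[OF f1])
  have IH0: "\<Phi> b \<le> expect E p (\<lambda>F. sqrt ((\<Phi> (f F))\<^sup>2 + ?G E f F))" (is "_ \<le> expect E p ?u")
    unfolding b_def by (rule insert.IH[OF f0])
  \<comment> \<open>A closed \<open>e\<close> adds its own increment to the gradient; an open
    \<open>e\<close> adds nothing (\<open>G1\<close>).\<close>
  have G0: "?G (insert e E) f F = ?G E f F + (f1 F - f F)\<^sup>2" if "F \<subseteq> E" for F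
  proof -
    have "insert e E - F = insert e (E - F)" using that insert.hyps by auto
    then show ?thesis using insert.hyps by (simp add: f1_def)
  qed
  have G1: "?G (insert e E) f (insert e F) = ?G E f1 F" if "F \<subseteq> E" for F
  proof -
    have "insert e E - insert e F = E - F" using insert.hyps by auto
    then show ?thesis by (simp add: f1_def insert_commute)
  qed
  \<comment> \<open>The induction hypothesis enters under the square root, where
    \<open>a - b\<close> is an expectation too; both coordinates are then averaged as one
    vector.\<close>
  have "sqrt ((\<Phi> b)\<^sup>2 + (a - b)\<^sup>2) \<le> sqrt ((expect E p ?u)\<^sup>2 + (expect E p (\<lambda>F. f1 F - f F))\<^sup>2)"
  proof (intro real_sqrt_le_mono add_mono)
    show "(a - b)\<^sup>2 \<le> (expect E p (\<lambda>F. f1 F - f F))\<^sup>2"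
      by (simp add: expect_diff a_def b_def)
    show "(\<Phi> b)\<^sup>2 \<le> (expect E p ?u)\<^sup>2"
      using ab by (intro power_mono IH0) (simp add: \<Phi>_def)
  qed
  also have "\<dots> \<le> expect E p (\<lambda>F. sqrt ((?u F)\<^sup>2 + (f1 F - f F)\<^sup>2))"
    by (rule expect_sqrt_sum_squares) fact+
  also have "\<dots> = expect E p (\<lambda>F. sqrt ((\<Phi> (f F))\<^sup>2 + ?G (insert e E) f F))"
    by (intro expect_cong) (auto simp: G0 sum_nonneg add_ac)
  finally have closed: "sqrt ((\<Phi> b)\<^sup>2 + (a - b)\<^sup>2) \<le> \<dots>" .
  have IH1': "\<Phi> a \<le> expect E p (\<lambda>F. sqrt ((\<Phi> (f (insert e F)))\<^sup>2 + ?G (insert e E) f (insert e F)))"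
    by (rule order.trans[OF IH1]) (auto intro!: eq_refl expect_cong simp only: G1 f1_def)
  have "\<Phi> (expect (insert e E) p f) = \<Phi> (p * a + (1 - p) * b)"
    using insert.hyps by (simp add: expect_insert a_def b_def f1_def[abs_def])
  also have "\<dots> \<le> p * \<Phi> a + (1 - p) * sqrt ((\<Phi> b)\<^sup>2 + (a - b)\<^sup>2)"
    unfolding \<Phi>_def by (rule two_point_inequality) (use assms(2,3) ab in auto)
  also have "\<dots> \<le> p * expect E p (\<lambda>F. sqrt ((\<Phi> (f (insert e F)))\<^sup>2 + ?G (insert e E) f (insert e F)))
      + (1 - p) * expect E p (\<lambda>F. sqrt ((\<Phi> (f F))\<^sup>2 + ?G (insert e E) f F))"
    using IH1' closed assms(2,3) by (intro add_mono mult_left_mono) auto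
  also have "\<dots> = expect (insert e E) p (\<lambda>F. sqrt ((\<Phi> (f F))\<^sup>2 + ?G (insert e E) f F))"
    using insert.hyps by (simp add: expect_insert)
  finally show ?case .
qed

text \<open>Subadditivity of the square root splits off \<Phi>(f), and for \<Phi>(x) = x(1-x)/2 the
  difference of \<Phi>(E f) and E \<Phi>(f) is half the variance.\<close>

lemma variance_le_gradient:
  fixes f :: "'b set \<Rightarrow> real"
  assumes "finite E" "0 \<le> p" "p \<le> 1" "\<And>F. F \<subseteq> E \<Longrightarrow> 0 \<le> f F \<and> f F \<le> 1"
  shows "expect E p (\<lambda>F. (f F - expect E p f)\<^sup>2) \<le>
    2 * expect E p (\<lambda>F. sqrt (\<Sum>e\<in>E - F. (f (insert e F) - f F)\<^sup>2))"
proof -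
  let ?G = "\<lambda>F. (\<Sum>e\<in>E - F. (f (insert e F) - f F)\<^sup>2)"
  define m where "m = expect E p f"
  have "m * (1 - m) / 2 \<le> expect E p (\<lambda>F. sqrt ((f F * (1 - f F) / 2)\<^sup>2 + ?G F))"
    unfolding m_def by (rule isoperimetric_inequality) fact+
  also have "\<dots> \<le> expect E p (\<lambda>F. f F * (1 - f F) / 2 + sqrt (?G F))"
  proof (intro expect_mono assms)
    fix F assume "F \<subseteq> E"
    then have "0 \<le> f F * (1 - f F) / 2" using assms(4)[of F] by simp
    then show "sqrt ((f F * (1 - f F) / 2)\<^sup>2 + ?G F) \<le> f F * (1 - f F) / 2 + sqrt (?G F)"
      using sqrt_add_le_add_sqrt[of "(f F * (1 - f F) / 2)\<^sup>2" "?G F"]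
      by (simp add: sum_nonneg)
  qed
  also have "\<dots> = (m - expect E p (\<lambda>F. (f F)\<^sup>2)) / 2 + expect E p (\<lambda>F. sqrt (?G F))"
  proof -
    have "(\<lambda>F. f F * (1 - f F) / 2) = (\<lambda>F. (1/2) * (f F - (f F)\<^sup>2))"
      by (auto simp: power2_eq_square field_simps)
    then show ?thesis
      unfolding expect_add by (simp only: expect_cmult expect_diff) (simp add: m_def)
  qed
  finally have "m * (1 - m) / 2 \<le> \<dots>" .
  moreover have "A - m\<^sup>2 \<le> 2 * B" if "m * (1 - m) / 2 \<le> (m - A) / 2 + B" for A B
    using that by (simp add: power2_eq_square field_simps)
  ultimately have *: "expect E p (\<lambda>F. (f F)\<^sup>2) - m\<^sup>2 \<le> 2 * expect E p (\<lambda>F. sqrt (?G F))"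
    by blast
  have "(\<lambda>F. (f F - m)\<^sup>2) = (\<lambda>F. ((f F)\<^sup>2 - 2 * m * f F) + m\<^sup>2)"
    by (auto simp: power2_eq_square algebra_simps)
  then have "expect E p (\<lambda>F. (f F - m)\<^sup>2) = expect E p (\<lambda>F. (f F)\<^sup>2) - 2 * m * m + m\<^sup>2"
    by (simp add: expect_add expect_diff expect_cmult[of E p "2 * m"] expect_const[OF assms(1)])
      (simp add: m_def)
  with * show ?thesis
    by (simp add: m_def power2_eq_square)
qed

section \<open>Dependence on the retention probability, and finite energy\<close>

text \<open>Conditioning on one edge turns the claim into the product rule. The increment for
  \<open>e\<close> does not depend on whether \<open>e\<close> lies in \<open>F\<close>, and
  \<open>f\<close> is arbitrary.\<close>

lemma Russo:
  assumes "finite E"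
  shows "((\<lambda>p. expect E p f) has_real_derivative
    (\<Sum>e\<in>E. expect E p (\<lambda>F. f (insert e F) - f (F - {e})))) (at p)"
  using assms
proof (induction E arbitrary: f rule: finite_induct)
  case empty
  then show ?case by simp
next
  case (insert e E)
  let ?D = "\<lambda>f. \<Sum>e\<in>E. expect E p (\<lambda>F. f (insert e F) - f (F - {e}))"
  let ?f1 = "\<lambda>F. f (insert e F)"
  have "((\<lambda>p. p * expect E p ?f1 + (1 - p) * expect E p f) has_real_derivative
    (expect E p ?f1 - expect E p f + (p * ?D ?f1 + (1 - p) * ?D f))) (at p)"
    by (rule derivative_eq_intros insert.IH refl)+ (simp add: algebra_simps)
  moreover have "expect (insert e E) p (\<lambda>F. f (insert e F) - f (F - {e})) = expect E p ?f1 - expect E p f"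
  proof -
    have "expect (insert e E) p (\<lambda>F. f (insert e F) - f (F - {e})) =
        expect (insert e E) p (\<lambda>F. f (insert e F)) - expect (insert e E) p (\<lambda>F. f (F - {e}))"
      by (rule expect_diff)
    also have "expect (insert e E) p (\<lambda>F. f (insert e F)) = expect E p ?f1"
      using insert.hyps by (simp add: expect_insert algebra_simps)
    also have "expect (insert e E) p (\<lambda>F. f (F - {e})) = expect E p (\<lambda>F. f (F - {e}))"
      using insert.hyps by (simp add: expect_insert algebra_simps)
    also have "\<dots> = expect E p f"
      using insert.hyps by (intro expect_cong arg_cong[of _ _ f]) auto
    finally show ?thesis .
  qed
  moreover have "(\<Sum>e'\<in>E. expect (insert e E) p (\<lambda>F. f (insert e' F) - f (F - {e'}))) =
      p * ?D ?f1 + (1 - p) * ?D f"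
    unfolding sum_distrib_left sum.distrib[symmetric]
  proof (intro sum.cong refl)
    fix e' assume e': "e' \<in> E"
    then have "insert e F - {e'} = insert e (F - {e'})" for F
      using insert.hyps by auto
    then show "expect (insert e E) p (\<lambda>F. f (insert e' F) - f (F - {e'})) =
      p * expect E p (\<lambda>F. ?f1 (insert e' F) - ?f1 (F - {e'})) +
      (1 - p) * expect E p (\<lambda>F. f (insert e' F) - f (F - {e'}))"
      using insert.hyps by (simp add: expect_insert insert_commute)
  qed
  ultimately have "((\<lambda>p. p * expect E p ?f1 + (1 - p) * expect E p f) has_real_derivative
      (\<Sum>e'\<in>insert e E. expect (insert e E) p (\<lambda>F. f (insert e' F) - f (F - {e'})))) (at p)"
    by (simp only: sum.insert[OF insert.hyps])
  then show ?case
    by (simp only: expect_insert[OF insert.hyps])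
qed

text \<open>Finite energy: inserting \<open>e\<close> maps the configurations without
  \<open>e\<close> injectively to those with \<open>e\<close>, and the ratio (1-p)/p of their
  weights is at most 1/p.\<close>

lemma expect_closed_edge_le:
  assumes "finite E" "0 < p" "p \<le> 1" "e \<in> E" "\<And>F. F \<subseteq> E \<Longrightarrow> 0 \<le> f F"
  shows "expect E p (\<lambda>F. of_bool (e \<notin> F) * f (insert e F)) \<le> expect E p f / p"
proof -
  have f1: "0 \<le> expect (E - {e}) p (\<lambda>F. f (insert e F))" and f0: "0 \<le> expect (E - {e}) p f"
    using assms by (auto intro!: expect_nonneg assms(5))
  have "expect (E - {e}) p (\<lambda>F. of_bool (e \<notin> F) * f (insert e F)) =
      expect (E - {e}) p (\<lambda>F. f (insert e F))"
    by (rule expect_cong) auto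
  moreover have "expect (E - {e}) p (\<lambda>F. of_bool (e \<notin> insert e F) * f (insert e (insert e F))) = 0"
    by (simp add: expect_def)
  ultimately have "expect E p (\<lambda>F. of_bool (e \<notin> F) * f (insert e F)) =
      (1 - p) * expect (E - {e}) p (\<lambda>F. f (insert e F))"
    by (subst expect_remove[OF assms(1,4)]) simp
  also have "\<dots> \<le> expect (E - {e}) p (\<lambda>F. f (insert e F))"
    using assms f1 by (simp add: mult_left_le_one_le)
  also have "\<dots> \<le> expect E p f / p"
    using assms(2,3) mult_nonneg_nonneg[OF _ f0, of "1 - p"]
    by (subst expect_remove[OF assms(1,4), of p f]) (simp add: pos_le_divide_eq mult_ac)
  finally show ?thesis .
qed

lemma expect_closed_sum_le_derivative:
  assumes "finite E" "0 \<le> p" "p \<le> 1" "\<And>F F'. F \<subseteq> F' \<Longrightarrow> F' \<subseteq> E \<Longrightarrow> f F \<le> f F'"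
  shows "expect E p (\<lambda>F. \<Sum>e\<in>E - F. f (insert e F) - f F) \<le>
    (\<Sum>e\<in>E. expect E p (\<lambda>F. f (insert e F) - f (F - {e})))"
proof -
  have "expect E p (\<lambda>F. \<Sum>e\<in>E - F. f (insert e F) - f F) \<le>
      expect E p (\<lambda>F. \<Sum>e\<in>E. f (insert e F) - f (F - {e}))"
  proof (intro expect_mono assms)
    fix F assume F: "F \<subseteq> E"
    have "(\<Sum>e\<in>E - F. f (insert e F) - f F) = (\<Sum>e\<in>E - F. f (insert e F) - f (F - {e}))"
      by (intro sum.cong) auto
    also have "\<dots> \<le> (\<Sum>e\<in>E. f (insert e F) - f (F - {e}))"
      using assms(1) F by (intro sum_mono2) (auto intro!: assms(4))
    finally show "(\<Sum>e\<in>E - F. f (insert e F) - f F) \<le> (\<Sum>e\<in>E. f (insert e F) - f (F - {e}))" .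
  qed
  then show ?thesis
    by (simp add: expect_sum)
qed

lemma expect_mono_p:
  assumes "finite E" "0 \<le> p" "p \<le> q" "q \<le> 1"
    and "\<And>F F'. F \<subseteq> F' \<Longrightarrow> F' \<subseteq> E \<Longrightarrow> f F \<le> f F'"
  shows "expect E p f \<le> expect E q f"
proof (rule DERIV_nonneg_imp_nondecreasing[OF assms(3)])
  fix x assume "p \<le> x" "x \<le> q"
  then have "0 \<le> (\<Sum>e\<in>E. expect E x (\<lambda>F. f (insert e F) - f (F - {e})))"
    using assms(2,4) by (intro sum_nonneg expect_nonneg) (auto intro!: assms(5))
  then show "\<exists>y. ((\<lambda>p. expect E p f) has_real_derivative y) (at x) \<and> 0 \<le> y"
    using Russo[OF assms(1)] by blast
qed

lemma expect_card:
  assumes "finite E"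
  shows "expect E p (\<lambda>F. real (card F)) = p * real (card E)"
    and "expect E p (\<lambda>F. real (card (E - F))) = (1 - p) * real (card E)"
proof -
  show *: "expect E p (\<lambda>F. real (card F)) = p * real (card E)"
    using assms
  proof (induction E rule: finite_induct)
    case (insert e E)
    have "expect E p (\<lambda>F. real (card (insert e F))) = expect E p (\<lambda>F. real (card F) + 1)"
      using insert.hyps by (intro expect_cong) (subst card_insert_disjoint, auto intro: finite_subset)
    then show ?case
      using insert by (simp add: expect_insert expect_add expect_const algebra_simps)
  qed simp
  have "expect E p (\<lambda>F. real (card (E - F))) = expect E p (\<lambda>F. real (card E) - real (card F))"
    using assms by (intro expect_cong)
      (auto simp: card_Diff_subset finite_subset card_mono of_nat_diff)
  then show "expect E p (\<lambda>F. real (card (E - F))) = (1 - p) * real (card E)"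
    by (simp add: expect_diff expect_const assms * algebra_simps)
qed

section \<open>Clusters and their mergers\<close>

definition conn :: "'a set set \<Rightarrow> 'a \<Rightarrow> 'a \<Rightarrow> bool" where
  "conn F = (\<lambda>x y. {x, y} \<in> F)\<^sup>*\<^sup>*"

lemma conn_refl [simp]: "conn F v v"
  by (simp add: conn_def)

lemma conn_edge: "{v, w} \<in> F \<Longrightarrow> conn F v w"
  by (simp add: conn_def r_into_rtranclp)

lemma conn_trans: "conn F u v \<Longrightarrow> conn F v w \<Longrightarrow> conn F u w"
  unfolding conn_def by (rule rtranclp_trans)

lemma conn_induct [consumes 1, case_names refl step]:
  assumes "conn F v w" "P v"
    and "\<And>x y. conn F v x \<Longrightarrow> {x, y} \<in> F \<Longrightarrow> P x \<Longrightarrow> P y"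
  shows "P w"
  using assms unfolding conn_def by (rule rtranclp_induct)

lemma conn_sym: "conn F v w \<Longrightarrow> conn F w v"
proof (induction rule: conn_induct)
  case (step x y)
  then have "conn F y x"
    by (intro conn_edge) (simp add: insert_commute)
  then show ?case
    using step.IH by (rule conn_trans)
qed simp

lemma conn_mono: "F \<subseteq> F' \<Longrightarrow> conn F v w \<Longrightarrow> conn F' v w"
  unfolding conn_def by (erule rtranclp_mono[THEN predicate2D, rotated]) auto

text \<open>A connection that uses the new edge needs it only once, in one of its two
  directions.\<close>

lemma conn_insert:
  "conn (insert {x, y} F) v w \<longleftrightarrow>
     conn F v w \<or> conn F v x \<and> conn F y w \<or> conn F v y \<and> conn F x w"
proof
  assume "conn (insert {x, y} F) v w"
  then show "conn F v w \<or> conn F v x \<and> conn F y w \<or> conn F v y \<and> conn F x w"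
  proof (induction rule: conn_induct)
    case (step u w)
    from step.hyps(2) consider "conn F u w" | "u = x" "w = y" | "u = y" "w = x"
      by (auto simp: doubleton_eq_iff conn_edge)
    then show ?case
      using step.IH by cases (auto intro: conn_trans)
  qed simp
next
  have "conn (insert {x, y} F) x y" "conn (insert {x, y} F) y x"
    by (auto intro!: conn_edge simp: insert_commute)
  moreover have "conn (insert {x, y} F) a b" if "conn F a b" for a b
    using that by (rule conn_mono[rotated]) auto
  moreover assume "conn F v w \<or> conn F v x \<and> conn F y w \<or> conn F v y \<and> conn F x w"
  ultimately show "conn (insert {x, y} F) v w"
    by (blast intro: conn_trans)
qed

lemma component_conn: "component V F v = {w \<in> V. conn F v w}"
  by (simp add: component_def conn_def)

lemma component_subset: "component V F v \<subseteq> V"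
  by (auto simp: component_conn)

lemma component_self: "v \<in> V \<Longrightarrow> v \<in> component V F v"
  by (auto simp: component_conn)

lemma component_eq:
  assumes "w \<in> component V F v"
  shows "component V F w = component V F v"
  using assms conn_trans[of F v w] conn_trans[OF conn_sym, of F v w] by (auto simp: component_conn)

lemma component_mono: "F \<subseteq> F' \<Longrightarrow> component V F v \<subseteq> component V F' v"
  by (auto simp: component_conn intro: conn_mono)

lemma component_disjoint:
  assumes "w \<notin> component V F v" "w \<in> V"
  shows "component V F v \<inter> component V F w = {}"
proof -
  have "w \<in> component V F v" if "u \<in> component V F v" "u \<in> component V F w" for u
    using component_eq[OF that(1)] component_eq[OF that(2)] component_self[OF assms(2)] by metis
  then show ?thesis
    using assms(1) by blast
qed

text \<open>Also covers an edge inside one component, where the union is that component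
  itself.\<close>

lemma component_insert:
  assumes "x \<in> V" "y \<in> V" "v \<in> V"
  shows "component V (insert {x, y} F) v =
    (if v \<in> component V F x \<union> component V F y
     then component V F x \<union> component V F y else component V F v)"
proof -
  have sym: "conn F v x \<longleftrightarrow> conn F x v" "conn F v y \<longleftrightarrow> conn F y v"
    using conn_sym by metis+
  consider "conn F x v" | "conn F y v" | "\<not> conn F x v" "\<not> conn F y v"
    by blast
  then show ?thesis
  proof cases
    case 1
    then have "conn F v z \<longleftrightarrow> conn F x z" for z
      using conn_trans[of F x v z] conn_trans[OF conn_sym, of F x v z] by blast
    then show ?thesis
      using 1 assms sym by (auto simp: component_conn conn_insert)
  next
    case 2
    then have "conn F v z \<longleftrightarrow> conn F y z" for z
      using conn_trans[of F y v z] conn_trans[OF conn_sym, of F y v z] by blast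
    then show ?thesis
      using 2 assms sym by (auto simp: component_conn conn_insert)
  next
    case 3
    then show ?thesis
      using assms sym by (auto simp: component_conn conn_insert)
  qed
qed

section \<open>Bounded degree graphs and the normalised sum of squared component sizes\<close>

locale bounded_graph =
  fixes V :: "'a set" and E :: "'a set set" and d :: nat
  assumes graph: "finite_graph V E"
    and nonempty: "V \<noteq> {}"
    and degree_le: "\<And>v. v \<in> V \<Longrightarrow> degree E v \<le> d"
    and d_pos: "1 \<le> d"
begin

lemma finite_V: "finite V"
  using graph by (simp add: finite_graph_def)

lemma finite_E: "finite E"
proof (rule finite_subset)
  show "E \<subseteq> Pow V" using graph by (auto simp: finite_graph_def)
qed (simp add: finite_V)

lemma edgeE:
  assumes "e \<in> E"
  obtains x y where "e = {x, y}" "x \<noteq> y" "x \<in> V" "y \<in> V"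
  using assms graph by (force simp: finite_graph_def card_2_iff)

lemma edge_in_V: "{x, y} \<in> E \<Longrightarrow> x \<in> V \<and> y \<in> V"
  using graph by (force simp: finite_graph_def)

abbreviation "n \<equiv> real (card V)"

lemma n_pos: "0 < n"
  using nonempty finite_V by (simp add: card_gt_0_iff)

abbreviation C :: "'a set set \<Rightarrow> 'a \<Rightarrow> 'a set" where
  "C F v \<equiv> component V F v"

abbreviation sz :: "'a set set \<Rightarrow> 'a \<Rightarrow> real" where
  "sz F v \<equiv> real (card (C F v))"

lemma finite_component: "finite (C F v)"
  using component_subset finite_V by (rule finite_subset)

lemma sz_le: "sz F v \<le> n"
  using component_subset[of V F v] finite_V by (simp add: card_mono)

lemma sz_ge_1: "v \<in> V \<Longrightarrow> 1 \<le> sz F v"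
  using component_self[of v V F] finite_component[of F v] by (simp add: Suc_le_eq card_gt_0_iff) blast

lemma sz_mono: "F \<subseteq> F' \<Longrightarrow> sz F v \<le> sz F' v"
  using component_mono[of F F' V v] finite_component by (simp add: card_mono)

text \<open>
  Each component of size \<open>m\<close> contributes \<open>m\<^sup>2\<close> to the numerator.
\<close>

definition X :: "'a set set \<Rightarrow> real" where
  "X F = (\<Sum>v\<in>V. sz F v) / n\<^sup>2"

lemma X_nonneg: "0 \<le> X F"
  by (simp add: X_def sum_nonneg)

lemma X_le_1: "X F \<le> 1"
proof -
  have "(\<Sum>v\<in>V. sz F v) \<le> (\<Sum>v\<in>V. n)"
    by (intro sum_mono sz_le)
  then show ?thesis
    using n_pos by (simp add: X_def power2_eq_square)
qed

lemma X_mono: "F \<subseteq> F' \<Longrightarrow> X F \<le> X F'"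
  unfolding X_def by (intro divide_right_mono sum_mono sz_mono) auto

text \<open>When two components merge, each vertex of one gains the size of the other, which gives
  the same product twice.\<close>

lemma X_insert:
  assumes "x \<in> V" "y \<in> V"
  shows "X (insert {x, y} F) - X F = (if y \<in> C F x then 0 else 2 * sz F x * sz F y / n\<^sup>2)"
proof (cases "y \<in> C F x")
  case True
  then have "C F y = C F x" by (rule component_eq)
  then have "C (insert {x, y} F) v = C F v" if "v \<in> V" for v
    using component_insert[OF assms that, of F] component_eq[of v V F x] by auto
  then show ?thesis
    using True by (simp add: X_def)
next
  case False
  have disj: "C F x \<inter> C F y = {}"
    using False assms by (intro component_disjoint) auto
  have sub: "C F x \<union> C F y \<subseteq> V"
    by (auto simp: component_conn)
  have "(\<Sum>v\<in>V. sz (insert {x, y} F) v) - (\<Sum>v\<in>V. sz F v) =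
      (\<Sum>v\<in>V. if v \<in> C F x then sz F y else if v \<in> C F y then sz F x else 0)"
    unfolding sum_subtractf[symmetric]
  proof (intro sum.cong refl)
    fix v assume v: "v \<in> V"
    show "sz (insert {x, y} F) v - sz F v =
        (if v \<in> C F x then sz F y else if v \<in> C F y then sz F x else 0)"
      using component_insert[OF assms v, of F] component_eq[of v V F x] component_eq[of v V F y] disj
      by (auto simp: card_Un_disjoint finite_component)
  qed
  also have "\<dots> = (\<Sum>v\<in>C F x \<union> C F y. if v \<in> C F x then sz F y else if v \<in> C F y then sz F x else 0)"
    using sub by (intro sum.mono_neutral_right finite_V) auto
  also have "\<dots> = (\<Sum>v\<in>C F x. if v \<in> C F x then sz F y else if v \<in> C F y then sz F x else 0) +
      (\<Sum>v\<in>C F y. if v \<in> C F x then sz F y else if v \<in> C F y then sz F x else 0)"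
    using disj by (intro sum.union_disjoint finite_component)
  also have "\<dots> = (\<Sum>v\<in>C F x. sz F y) + (\<Sum>v\<in>C F y. sz F x)"
    using disj by (intro arg_cong2[of _ _ _ _ "(+)"] sum.cong) auto
  finally have *: "(\<Sum>v\<in>V. sz (insert {x, y} F) v) - (\<Sum>v\<in>V. sz F v) = 2 * sz F x * sz F y"
    by simp
  show ?thesis
    unfolding X_def diff_divide_distrib[symmetric] * using False by simp
qed

lemma X_ge_if_large:
  assumes "has_large_component V F c" "0 < c"
  shows "c\<^sup>2 \<le> X F"
proof -
  from assms obtain v where v: "v \<in> V" "c * n \<le> sz F v"
    by (auto simp: has_large_component_def)
  have "(c * n)\<^sup>2 \<le> (sz F v)\<^sup>2"
    using v assms(2) by (intro power_mono) auto
  also have "\<dots> = (\<Sum>w\<in>C F v. sz F w)"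
    using component_eq[of _ V F v] by (simp add: power2_eq_square)
  also have "\<dots> \<le> (\<Sum>w\<in>V. sz F w)"
    using component_subset[of V F v] finite_V by (intro sum_mono2) auto
  finally show ?thesis
    using n_pos by (simp add: X_def field_simps)
qed

lemma has_large_component_mono:
  "F \<subseteq> F' \<Longrightarrow> has_large_component V F c \<Longrightarrow> has_large_component V F' c"
  unfolding has_large_component_def by (meson order.trans sz_mono)

definition two_big :: "real \<Rightarrow> 'a set set \<Rightarrow> bool" where
  "two_big \<alpha> F \<longleftrightarrow> (\<exists>x\<in>V. \<exists>y\<in>V. y \<notin> C F x \<and> \<alpha> * n \<le> sz F x \<and> \<alpha> * n \<le> sz F y)"

text \<open>The vertices in components of size at least \<alpha> n all lie in one component, of size
  at most c n, and contribute at most (c n)^2. Each remaining vertex contributes at most \<alpha> n.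
  With \<open>X_ge_if_large\<close> this pins the typical value of \<open>X\<close> near c^2 when
  both alternatives have positive probability.\<close>

lemma X_le_if_not_large:
  assumes "\<not> has_large_component V F c" "\<not> two_big \<alpha> F" "0 < c" "0 < \<alpha>"
  shows "X F \<le> c\<^sup>2 + \<alpha>"
proof -
  let ?B = "{v\<in>V. \<alpha> * n \<le> sz F v}"
  have small: "sz F v \<le> c * n" if "v \<in> V" for v
    using assms(1) that by (force simp: has_large_component_def)
  have "(\<Sum>v\<in>?B. sz F v) \<le> (c * n)\<^sup>2"
  proof (cases "?B = {}")
    case False
    then obtain w where w: "w \<in> V" "\<alpha> * n \<le> sz F w" by auto
    then have "?B \<subseteq> C F w"
      using assms(2) by (auto simp: two_big_def)
    then have "real (card ?B) \<le> sz F w"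
      using finite_component by (simp add: card_mono)
    then have "real (card ?B) \<le> c * n"
      using small[OF w(1)] by linarith
    have "(\<Sum>v\<in>?B. sz F v) \<le> (\<Sum>v\<in>?B. c * n)"
      using small by (intro sum_mono) auto
    also have "\<dots> = real (card ?B) * (c * n)"
      by simp
    also have "\<dots> \<le> (c * n) * (c * n)"
      using \<open>real (card ?B) \<le> c * n\<close> assms(3) by (intro mult_right_mono) auto
    finally show ?thesis
      by (simp add: power2_eq_square)
  qed (simp only: sum.empty zero_le_power2)
  moreover have "(\<Sum>v\<in>V - ?B. sz F v) \<le> n * (\<alpha> * n)"
  proof -
    have "(\<Sum>v\<in>V - ?B. sz F v) \<le> (\<Sum>v\<in>V - ?B. \<alpha> * n)"
      by (intro sum_mono) auto
    also have "\<dots> \<le> (\<Sum>v\<in>V. \<alpha> * n)"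
      using finite_V assms(4) by (intro sum_mono2) auto
    finally show ?thesis by simp
  qed
  moreover have "(\<Sum>v\<in>V. sz F v) = (\<Sum>v\<in>V - ?B. sz F v) + (\<Sum>v\<in>?B. sz F v)"
    by (rule sum.subset_diff) (auto simp: finite_V)
  ultimately have "(\<Sum>v\<in>V. sz F v) \<le> (c\<^sup>2 + \<alpha>) * n\<^sup>2"
    by (simp add: power2_eq_square algebra_simps)
  then show ?thesis
    using n_pos by (simp add: X_def field_simps)
qed

section \<open>Mergers and the gradient of \<open>X\<close>\<close>

text \<open>The l1 norm of the one-sided gradient of \<open>X\<close>; its expectation is at most
  Russo's derivative of E X.\<close>

definition merge_sum :: "'a set set \<Rightarrow> real" where
  "merge_sum F = (\<Sum>e\<in>E - F. X (insert e F) - X F)"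

definition joining :: "real \<Rightarrow> 'a set set \<Rightarrow> 'a set \<Rightarrow> bool" where
  "joining \<alpha> F e \<longleftrightarrow> e \<notin> F \<and>
     (\<exists>x y. e = {x, y} \<and> y \<notin> C F x \<and> \<alpha> * n \<le> sz F x \<and> \<alpha> * n \<le> sz F y)"

text \<open>The \<open>N\<close> of the overview, summed over a range that does not depend on
  \<open>F\<close>, so that its expectation splits edge by edge.\<close>

definition join_count :: "real \<Rightarrow> 'a set set \<Rightarrow> real" where
  "join_count \<alpha> F = (\<Sum>e\<in>E. of_bool (joining \<alpha> F e))"

lemma join_count_nonneg: "0 \<le> join_count \<alpha> F"
  by (simp add: join_count_def sum_nonneg)

lemma join_count_nonzero:
  assumes "join_count \<alpha> F \<noteq> 0"
  shows "two_big \<alpha> F"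
proof -
  obtain e where "e \<in> E" "joining \<alpha> F e"
    using assms unfolding join_count_def by (metis (mono_tags) of_bool_eq(1) sum.neutral)
  then show ?thesis
    using edge_in_V unfolding joining_def two_big_def by metis
qed

lemma X_insert_joining:
  assumes "e \<in> E" "joining \<alpha> F e" "0 < \<alpha>"
  shows "2 * \<alpha>\<^sup>2 \<le> X (insert e F) - X F"
proof -
  obtain x y where e: "e = {x, y}" "y \<notin> C F x" "\<alpha> * n \<le> sz F x" "\<alpha> * n \<le> sz F y"
    using assms(2) by (auto simp: joining_def)
  have "(\<alpha> * n) * (\<alpha> * n) \<le> sz F x * sz F y"
    using e assms(3) by (intro mult_mono) auto
  then have "2 * \<alpha>\<^sup>2 \<le> 2 * sz F x * sz F y / n\<^sup>2"
    using n_pos by (simp add: power2_eq_square field_simps)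
  then show ?thesis
    using e X_insert[of x y F] edge_in_V[of x y] assms(1) by simp
qed

lemma X_insert_not_joining:
  assumes "e \<in> E" "e \<notin> F" "\<not> joining \<alpha> F e" "0 < \<alpha>"
  shows "X (insert e F) - X F \<le> 2 * \<alpha>"
proof -
  obtain x y where e: "e = {x, y}" "x \<in> V" "y \<in> V"
    using assms(1) by (rule edgeE)
  show ?thesis
  proof (cases "y \<in> C F x")
    case True
    then show ?thesis using X_insert[OF e(2,3), of F] e(1) assms(4) by simp
  next
    case False
    then have "sz F x \<le> \<alpha> * n \<or> sz F y \<le> \<alpha> * n"
      using assms e by (force simp: joining_def)
    then have "sz F x * sz F y \<le> \<alpha> * n * n"
    proof
      assume "sz F x \<le> \<alpha> * n"
      then show ?thesis using sz_le[of F y] assms(4) by (intro mult_mono) auto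
    next
      assume "sz F y \<le> \<alpha> * n"
      then have "sz F y * sz F x \<le> \<alpha> * n * n" using sz_le[of F x] assms(4) by (intro mult_mono) auto
      then show ?thesis by (simp add: mult.commute)
    qed
    then have "2 * sz F x * sz F y / n\<^sup>2 \<le> 2 * \<alpha>"
      using n_pos by (simp add: power2_eq_square field_simps)
    then show ?thesis
      using False X_insert[OF e(2,3), of F] e(1) by simp
  qed
qed

lemma merge_sum_nonneg: "0 \<le> merge_sum F"
  unfolding merge_sum_def by (intro sum_nonneg) (simp add: X_mono subset_insertI)

text \<open>Every joining edge raises \<open>X\<close> by at least 2 \<alpha>^2, so a derivative
  bound at a good point keeps E N bounded.\<close>

lemma join_count_le:
  assumes "0 < \<alpha>"
  shows "2 * \<alpha>\<^sup>2 * join_count \<alpha> F \<le> merge_sum F"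
proof -
  have "join_count \<alpha> F = (\<Sum>e\<in>E - F. of_bool (joining \<alpha> F e))"
    unfolding join_count_def
    using finite_E by (intro sum.mono_neutral_right) (auto simp: joining_def)
  then have "2 * \<alpha>\<^sup>2 * join_count \<alpha> F = (\<Sum>e\<in>E - F. 2 * \<alpha>\<^sup>2 * of_bool (joining \<alpha> F e))"
    by (simp add: sum_distrib_left)
  also have "\<dots> \<le> merge_sum F"
    unfolding merge_sum_def
    using X_insert_joining[OF _ _ assms] X_mono[of F "insert _ F"]
    by (intro sum_mono) (auto simp: of_bool_def subset_insertI)
  finally show ?thesis .
qed

text \<open>An edge that is not joining has increment at most 2 \<alpha>, hence its square is at
  most 2 \<alpha> times the increment; a joining edge has squared increment at most 1.\<close>

lemma sqrt_gradient_le: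
  assumes "0 < \<alpha>"
  shows "sqrt (\<Sum>e\<in>E - F. (X (insert e F) - X F)\<^sup>2) \<le>
    sqrt (2 * \<alpha> * merge_sum F) + sqrt (join_count \<alpha> F)"
proof -
  have "(\<Sum>e\<in>E - F. (X (insert e F) - X F)\<^sup>2) \<le>
      (\<Sum>e\<in>E - F. 2 * \<alpha> * (X (insert e F) - X F) + of_bool (joining \<alpha> F e))"
  proof (intro sum_mono)
    fix e assume e: "e \<in> E - F"
    let ?D = "X (insert e F) - X F"
    have D: "0 \<le> ?D" "?D \<le> 1"
      using X_mono[of F "insert e F"] X_le_1[of "insert e F"] X_nonneg[of F] by auto
    show "?D\<^sup>2 \<le> 2 * \<alpha> * ?D + of_bool (joining \<alpha> F e)"
    proof (cases "joining \<alpha> F e")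
      case True
      have "?D\<^sup>2 \<le> 1" using D by (simp add: power_le_one)
      moreover have "0 \<le> 2 * \<alpha> * ?D" using D assms by simp
      ultimately show ?thesis using True by simp
    next
      case False
      then have "?D * ?D \<le> 2 * \<alpha> * ?D"
        using D X_insert_not_joining[of e F \<alpha>] e assms by (intro mult_right_mono) auto
      then show ?thesis using False by (simp add: power2_eq_square)
    qed
  qed
  also have "\<dots> = 2 * \<alpha> * merge_sum F + (\<Sum>e\<in>E - F. of_bool (joining \<alpha> F e))"
    by (simp add: sum.distrib merge_sum_def sum_distrib_left)
  also have "\<dots> \<le> 2 * \<alpha> * merge_sum F + join_count \<alpha> F"
    unfolding join_count_def using finite_E by (intro add_left_mono sum_mono2) auto
  finally have "sqrt (\<Sum>e\<in>E - F. (X (insert e F) - X F)\<^sup>2) \<le> sqrt (2 * \<alpha> * merge_sum F + join_count \<alpha> F)"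
    by simp
  also have "\<dots> \<le> sqrt (2 * \<alpha> * merge_sum F) + sqrt (join_count \<alpha> F)"
    using assms merge_sum_nonneg join_count_nonneg by (intro sqrt_add_le_add_sqrt) auto
  finally show ?thesis .
qed

text \<open>The small increments are handled by Jensen, the joining edges by Cauchy-Schwarz on the
  event that two big components exist.\<close>

lemma variance_X_le:
  assumes "0 \<le> p" "p \<le> 1" "0 < \<alpha>"
  shows "expect E p (\<lambda>F. (X F - expect E p X)\<^sup>2) \<le>
    2 * (sqrt (2 * \<alpha> * expect E p merge_sum) +
         sqrt (expect E p (\<lambda>F. of_bool (two_big \<alpha> F)) * expect E p (join_count \<alpha>)))"
proof -
  have "expect E p (\<lambda>F. (X F - expect E p X)\<^sup>2) \<le>
      2 * expect E p (\<lambda>F. sqrt (\<Sum>e\<in>E - F. (X (insert e F) - X F)\<^sup>2))"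
    using X_nonneg X_le_1 by (intro variance_le_gradient finite_E assms) auto
  also have "expect E p (\<lambda>F. sqrt (\<Sum>e\<in>E - F. (X (insert e F) - X F)\<^sup>2)) \<le>
      expect E p (\<lambda>F. sqrt (2 * \<alpha> * merge_sum F) + sqrt (join_count \<alpha> F))"
    using assms by (intro expect_mono sqrt_gradient_le) auto
  also have "\<dots> = expect E p (\<lambda>F. sqrt (2 * \<alpha> * merge_sum F)) + expect E p (\<lambda>F. sqrt (join_count \<alpha> F))"
    by (rule expect_add)
  also have "expect E p (\<lambda>F. sqrt (2 * \<alpha> * merge_sum F)) \<le> sqrt (expect E p (\<lambda>F. 2 * \<alpha> * merge_sum F))"
    using assms merge_sum_nonneg by (intro expect_sqrt_le finite_E) auto
  also have "expect E p (\<lambda>F. 2 * \<alpha> * merge_sum F) = 2 * \<alpha> * expect E p merge_sum"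
    by (rule expect_cmult)
  also have "expect E p (\<lambda>F. sqrt (join_count \<alpha> F)) \<le>
      sqrt (expect E p (\<lambda>F. of_bool (join_count \<alpha> F \<noteq> 0)) * expect E p (join_count \<alpha>))"
    using assms join_count_nonneg by (intro expect_Cauchy_Schwarz) auto
  also have "\<dots> \<le> sqrt (expect E p (\<lambda>F. of_bool (two_big \<alpha> F)) * expect E p (join_count \<alpha>))"
    using assms join_count_nonneg
    by (intro real_sqrt_le_mono mult_right_mono expect_mono expect_nonneg)
      (auto simp: join_count_nonzero)
  finally show ?thesis by simp
qed

section \<open>Short paths between big components\<close>

text \<open>Distance at most \<open>k\<close> in the whole graph, whichever edges are open.\<close>

fun near :: "nat \<Rightarrow> 'a \<Rightarrow> 'a \<Rightarrow> bool" where
  "near 0 v w \<longleftrightarrow> v = w"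
| "near (Suc k) v w \<longleftrightarrow> v = w \<or> (\<exists>u. {v, u} \<in> E \<and> near k u w)"

lemma near_Suc: "near k v w \<Longrightarrow> near (Suc k) v w"
  by (induction k arbitrary: v) auto

text \<open>Stated per vertex: two big components will produce linearly many such \<open>v\<close>,
  and this is where the factor \<open>n\<close> in the bound on \<open>two_big\<close> comes
  from.\<close>

definition bridge :: "real \<Rightarrow> nat \<Rightarrow> 'a set set \<Rightarrow> 'a \<Rightarrow> bool" where
  "bridge \<alpha> k F v \<longleftrightarrow> \<alpha> * n \<le> sz F v \<and>
     (\<exists>w\<in>V. near k v w \<and> w \<notin> C F v \<and> \<alpha> * n \<le> sz F w)"

text \<open>Take the first edge of a short path from \<open>v\<close> to \<open>w\<close>. If
  \<open>u\<close> lies in the component of \<open>v\<close>, the path gets shorter. If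
  \<open>u\<close> lies in another big component, the edge is joining. Otherwise the component of
  \<open>u\<close> is small, hence not that of \<open>w\<close>, and opening the edge absorbs it
  without touching the component of \<open>w\<close>.\<close>

lemma bridge_step:
  assumes "bridge \<alpha> (Suc k) F v" "v \<in> V"
  obtains u where "{v, u} \<in> E"
    "bridge \<alpha> k F u \<or> joining \<alpha> F {v, u} \<or> {v, u} \<notin> F \<and> bridge \<alpha> k (insert {v, u} F) u"
proof -
  from assms obtain w where w: "w \<in> V" "near (Suc k) v w" "w \<notin> C F v" "\<alpha> * n \<le> sz F w"
    and v: "\<alpha> * n \<le> sz F v"
    by (auto simp: bridge_def)
  have "v \<noteq> w"
    using w(3) component_self[OF assms(2)] by auto
  then obtain u where u: "{v, u} \<in> E" "near k u w"
    using w(2) by auto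
  then have uV: "u \<in> V" using edge_in_V by blast
  consider "u \<in> C F v" | "u \<notin> C F v" "\<alpha> * n \<le> sz F u" | "u \<notin> C F v" "\<not> \<alpha> * n \<le> sz F u"
    by blast
  then show thesis
  proof cases
    case 1
    then have "C F u = C F v" by (rule component_eq)
    then have "bridge \<alpha> k F u"
      using w v u by (auto simp: bridge_def)
    then show thesis using that u by blast
  next
    case 2
    have "{v, u} \<notin> F"
      using 2(1) uV by (auto simp: component_conn dest: conn_edge)
    then have "joining \<alpha> F {v, u}"
      using 2 v by (auto simp: joining_def)
    then show thesis using that u by blast
  next
    case 3
    have notin: "{v, u} \<notin> F"
      using 3(1) uV by (auto simp: component_conn dest: conn_edge)
    have "w \<notin> C F u"
      using component_eq[of w V F u] 3(2) w(4) by auto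
    then have w': "w \<notin> C F v \<union> C F u" using w(3) by auto
    have Cu: "C (insert {v, u} F) u = C F v \<union> C F u"
      using component_insert[OF assms(2) uV uV, of F] component_self[OF uV, of F] by simp
    have Cw: "C (insert {v, u} F) w = C F w"
      using component_insert[OF assms(2) uV w(1), of F] w' by simp
    have "sz F v \<le> real (card (C F v \<union> C F u))"
      using finite_component by (simp add: card_mono)
    then have "bridge \<alpha> k (insert {v, u} F) u"
      unfolding bridge_def Cu using w w' u(2) v Cw by auto
    then show thesis using that u notin by blast
  qed
qed

text \<open>Handshake counting over oriented edges (darts).\<close>

lemma sum_darts:
  fixes h :: "'a set \<Rightarrow> real"
  shows "(\<Sum>v\<in>V. \<Sum>u\<in>{u. {v, u} \<in> E}. h {v, u}) = 2 * (\<Sum>e\<in>E. h e)"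
proof -
  have "(\<Sum>u\<in>{u. {v, u} \<in> E}. h {v, u}) = (\<Sum>e\<in>{e\<in>E. v \<in> e}. h e)" if "v \<in> V" for v
  proof (rule sum.reindex_bij_betw)
    show "bij_betw (\<lambda>u. {v, u}) {u. {v, u} \<in> E} {e \<in> E. v \<in> e}"
      unfolding bij_betw_def
    proof
      show "inj_on (\<lambda>u. {v, u}) {u. {v, u} \<in> E}"
        by (auto simp: inj_on_def doubleton_eq_iff)
      show "(\<lambda>u. {v, u}) ` {u. {v, u} \<in> E} = {e \<in> E. v \<in> e}"
      proof (intro equalityI subsetI)
        fix e assume "e \<in> {e \<in> E. v \<in> e}"
        then have e: "e \<in> E" "v \<in> e" by auto
        from e(1) obtain x y where "e = {x, y}" by (rule edgeE)
        then obtain u where "e = {v, u}" using e(2) by (auto simp: insert_commute)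
        then show "e \<in> (\<lambda>u. {v, u}) ` {u. {v, u} \<in> E}" using e by auto
      qed auto
    qed
  qed
  then have "(\<Sum>v\<in>V. \<Sum>u\<in>{u. {v, u} \<in> E}. h {v, u}) = (\<Sum>v\<in>V. \<Sum>e\<in>{e\<in>E. v \<in> e}. h e)"
    by (intro sum.cong) auto
  also have "\<dots> = (\<Sum>e\<in>E. \<Sum>v\<in>{v\<in>V. v \<in> e}. h e)"
    by (rule sum.swap_restrict[OF finite_V finite_E])
  also have "\<dots> = (\<Sum>e\<in>E. 2 * h e)"
  proof (intro sum.cong refl)
    fix e assume "e \<in> E"
    then obtain x y where "e = {x, y}" "x \<noteq> y" "x \<in> V" "y \<in> V" by (rule edgeE)
    then have "{v\<in>V. v \<in> e} = {x, y}" by auto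
    then show "(\<Sum>v\<in>{v\<in>V. v \<in> e}. h e) = 2 * h e" using \<open>x \<noteq> y\<close> by simp
  qed
  finally show ?thesis by (simp add: sum_distrib_left)
qed

lemma card_neighbours: "v \<in> V \<Longrightarrow> card {u. {v, u} \<in> E} \<le> d"
proof -
  assume v: "v \<in> V"
  have "card {u. {v, u} \<in> E} \<le> card {e \<in> E. v \<in> e}"
    by (rule card_inj_on_le[where f = "\<lambda>u. {v, u}"])
      (auto simp: inj_on_def doubleton_eq_iff finite_E)
  then show ?thesis
    using degree_le[OF v] by (simp add: degree_def)
qed

lemma finite_neighbours: "finite {u. {v, u} \<in> E}"
  by (rule finite_subset[OF _ finite_V]) (use edge_in_V in blast)

lemma sum_dart_heads_le:
  fixes h :: "'a \<Rightarrow> real"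
  assumes "\<And>v. v \<in> V \<Longrightarrow> 0 \<le> h v"
  shows "(\<Sum>v\<in>V. \<Sum>u\<in>{u. {v, u} \<in> E}. h u) \<le> d * (\<Sum>v\<in>V. h v)"
proof -
  have nb: "{u. {v, u} \<in> E} = {u\<in>V. {u, v} \<in> E}" for v
    using edge_in_V by (auto simp: insert_commute)
  have "(\<Sum>v\<in>V. \<Sum>u\<in>{u. {v, u} \<in> E}. h u) = (\<Sum>v\<in>V. \<Sum>u\<in>{u\<in>V. {u, v} \<in> E}. h u)"
    by (simp only: nb)
  also have "\<dots> = (\<Sum>u\<in>V. \<Sum>v\<in>{v\<in>V. {u, v} \<in> E}. h u)"
    by (rule sum.swap_restrict[OF finite_V finite_V])
  also have "\<dots> \<le> (\<Sum>u\<in>V. d * h u)"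
  proof (intro sum_mono)
    fix u assume u: "u \<in> V"
    have "{v\<in>V. {u, v} \<in> E} = {v. {u, v} \<in> E}" using edge_in_V by auto
    then show "(\<Sum>v\<in>{v\<in>V. {u, v} \<in> E}. h u) \<le> d * h u"
      using card_neighbours[OF u] assms[OF u] by (simp add: mult_right_mono)
  qed
  finally show ?thesis by (simp add: sum_distrib_left)
qed

text \<open>A union bound over the neighbours in \<open>bridge_step\<close>. The shortened path
  costs a factor 1, the opened edge a factor 1/p by finite energy, and each joining edge is met from
  both of its endpoints.\<close>

lemma bridge_sum_le:
  fixes p :: real
  assumes "0 < p" "p \<le> 1"
  shows "(\<Sum>v\<in>V. expect E p (\<lambda>F. of_bool (bridge \<alpha> (Suc k) F v))) \<le>
    d * (1 + 1 / p) * (\<Sum>v\<in>V. expect E p (\<lambda>F. of_bool (bridge \<alpha> k F v))) +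
    2 * expect E p (join_count \<alpha>)"
proof -
  let ?P = "\<lambda>v. expect E p (\<lambda>F. of_bool (bridge \<alpha> k F v))"
  let ?J = "\<lambda>e. expect E p (\<lambda>F. of_bool (joining \<alpha> F e))"
  have P_nonneg: "0 \<le> ?P v" for v
    using assms by (intro expect_nonneg) auto
  have "expect E p (\<lambda>F. of_bool (bridge \<alpha> (Suc k) F v)) \<le>
      (\<Sum>u\<in>{u. {v, u} \<in> E}. (1 + 1 / p) * ?P u + ?J {v, u})" if v: "v \<in> V" for v
  proof -
    let ?t = "\<lambda>u F. of_bool (bridge \<alpha> k F u) + of_bool (joining \<alpha> F {v, u}) +
      of_bool ({v, u} \<notin> F) * of_bool (bridge \<alpha> k (insert {v, u} F) u) :: real"
    have "expect E p (\<lambda>F. of_bool (bridge \<alpha> (Suc k) F v)) \<le>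
        expect E p (\<lambda>F. \<Sum>u\<in>{u. {v, u} \<in> E}. ?t u F)"
    proof (intro expect_mono)
      fix F
      show "of_bool (bridge \<alpha> (Suc k) F v) \<le> (\<Sum>u\<in>{u. {v, u} \<in> E}. ?t u F)"
      proof (cases "bridge \<alpha> (Suc k) F v")
        case True
        then obtain u where u: "{v, u} \<in> E"
          "bridge \<alpha> k F u \<or> joining \<alpha> F {v, u} \<or> {v, u} \<notin> F \<and> bridge \<alpha> k (insert {v, u} F) u"
          using v by (rule bridge_step)
        then have "1 \<le> ?t u F" by auto
        also have "\<dots> \<le> (\<Sum>u\<in>{u. {v, u} \<in> E}. ?t u F)"
          using u(1) finite_neighbours by (intro member_le_sum) auto
        finally show ?thesis using True by simp
      qed (simp add: sum_nonneg)
    qed (use assms in auto)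
    also have "\<dots> = (\<Sum>u\<in>{u. {v, u} \<in> E}. expect E p (?t u))"
      by (rule expect_sum)
    also have "\<dots> \<le> (\<Sum>u\<in>{u. {v, u} \<in> E}. (1 + 1 / p) * ?P u + ?J {v, u})"
    proof (intro sum_mono)
      fix u assume "u \<in> {u. {v, u} \<in> E}"
      then have "expect E p (\<lambda>F. of_bool ({v, u} \<notin> F) * of_bool (bridge \<alpha> k (insert {v, u} F) u)) \<le> ?P u / p"
        using assms by (intro expect_closed_edge_le[where f = "\<lambda>F. of_bool (bridge \<alpha> k F u)"] finite_E) auto
      then show "expect E p (?t u) \<le> (1 + 1 / p) * ?P u + ?J {v, u}"
        by (simp add: expect_add algebra_simps)
    qed
    finally show ?thesis .
  qed
  then have "(\<Sum>v\<in>V. expect E p (\<lambda>F. of_bool (bridge \<alpha> (Suc k) F v))) \<le>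
      (\<Sum>v\<in>V. \<Sum>u\<in>{u. {v, u} \<in> E}. (1 + 1 / p) * ?P u + ?J {v, u})"
    by (intro sum_mono)
  also have "\<dots> = (1 + 1 / p) * (\<Sum>v\<in>V. \<Sum>u\<in>{u. {v, u} \<in> E}. ?P u) +
      (\<Sum>v\<in>V. \<Sum>u\<in>{u. {v, u} \<in> E}. ?J {v, u})"
    by (simp add: sum.distrib sum_distrib_left)
  also have "(\<Sum>v\<in>V. \<Sum>u\<in>{u. {v, u} \<in> E}. ?J {v, u}) = 2 * expect E p (join_count \<alpha>)"
    unfolding sum_darts[of ?J] join_count_def[abs_def] expect_sum ..
  also have "(1 + 1 / p) * (\<Sum>v\<in>V. \<Sum>u\<in>{u. {v, u} \<in> E}. ?P u) \<le> (1 + 1 / p) * (d * (\<Sum>v\<in>V. ?P v))"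
    using assms P_nonneg by (intro mult_left_mono sum_dart_heads_le) auto
  finally show ?thesis
    by (simp add: mult_ac)
qed

end

section \<open>Expansion\<close>

locale expander_graph = bounded_graph +
  fixes b :: real
  assumes b_pos: "0 < b" and cheeger: "cheeger_gt V E b"
begin

text \<open>The Cheeger bound is applied to the smaller of \<open>A\<close> and its complement,
  which have the same boundary.\<close>

lemma boundary_ge:
  assumes "A \<subseteq> V" "m \<le> real (card A)" "m \<le> n - real (card A)"
  shows "b * m \<le> real (card (edge_boundary V E A))"
proof -
  have cheeger': "b * real (card B) \<le> real (card (edge_boundary V E B))"
    if "B \<subseteq> V" "real (card B) \<le> n / 2" for B
  proof (cases "card B = 0")
    case False
    then have "b < real (card (edge_boundary V E B)) / real (card B)"
      using cheeger that by (auto simp: cheeger_gt_def)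
    then show ?thesis using False by (simp add: field_simps)
  qed simp
  show ?thesis
  proof (cases "real (card A) \<le> n / 2")
    case True
    have "b * m \<le> b * real (card A)" using b_pos assms by simp
    then show ?thesis using cheeger'[OF assms(1) True] by linarith
  next
    case False
    have card: "real (card (V - A)) = n - real (card A)"
      using assms(1) finite_V by (simp add: card_Diff_subset finite_subset card_mono of_nat_diff)
    have "b * m \<le> b * real (card (V - A))" using b_pos assms card by simp
    also have "\<dots> \<le> real (card (edge_boundary V E (V - A)))"
      using False card by (intro cheeger') auto
    also have "edge_boundary V E (V - A) = edge_boundary V E A"
      using assms(1) by (auto simp: edge_boundary_def double_diff)
    finally show ?thesis .
  qed
qed

text \<open>Both the component and its complement have at least (1-c) times the size of the
  component, since the latter is at most c n.\<close>

lemma component_boundary_ge: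
  assumes "v \<in> V" "\<not> has_large_component V F c" "0 < c" "c < 1"
  shows "b * (1 - c) * sz F v \<le> real (card (edge_boundary V E (C F v)))"
proof -
  have "sz F v \<le> c * n"
    using assms by (force simp: has_large_component_def)
  moreover have "(1 - c) * sz F v \<le> (1 - c) * n"
    using sz_le[of F v] assms by (intro mult_left_mono) auto
  moreover have "(1 - c) * sz F v \<le> 1 * sz F v"
    using assms by (intro mult_right_mono) auto
  ultimately have "b * ((1 - c) * sz F v) \<le> real (card (edge_boundary V E (C F v)))"
    by (intro boundary_ge component_subset) (auto simp: algebra_simps)
  then show ?thesis by (simp add: mult_ac)
qed

lemma edge_boundary_component:
  assumes "{x, y} \<in> E" "v \<in> V" "{x, y} \<in> edge_boundary V E (C F v)"
  shows "{x, y} \<notin> F" "y \<notin> C F x" "v \<in> C F x \<union> C F y"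
proof -
  have xy: "x \<in> V" "y \<in> V" using edge_in_V assms(1) by auto
  have "x \<in> C F v \<and> y \<notin> C F v \<or> y \<in> C F v \<and> x \<notin> C F v"
    using assms(3) by (auto simp: edge_boundary_def)
  then have "y \<notin> C F x \<and> v \<in> C F x \<union> C F y"
    using component_eq[of x V F v] component_eq[of y V F v] component_eq[of y V F x]
      component_self[OF assms(2), of F] component_self[OF xy(1), of F] component_self[OF xy(2), of F]
    by auto
  then show "y \<notin> C F x" "v \<in> C F x \<union> C F y" by auto
  then show "{x, y} \<notin> F"
    using xy by (auto simp: component_conn dest: conn_edge)
qed

text \<open>Double counting of pairs of a vertex and a boundary edge of its component; such edges
  are closed. The weights 1 and \<open>1 / sz F v\<close> give the two lower bounds that
  follow.\<close>

lemma sum_boundary_swap: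
  fixes h :: "'a \<Rightarrow> real"
  shows "(\<Sum>v\<in>V. real (card (edge_boundary V E (C F v))) * h v) =
    (\<Sum>e\<in>E - F. \<Sum>v\<in>{v\<in>V. e \<in> edge_boundary V E (C F v)}. h v)"
proof -
  have "edge_boundary V E (C F v) = {e\<in>E - F. e \<in> edge_boundary V E (C F v)}" if "v \<in> V" for v
  proof -
    have "e \<in> E - F" if "e \<in> edge_boundary V E (C F v)" for e
    proof -
      have "e \<in> E" using that by (simp add: edge_boundary_def)
      then obtain x y where "e = {x, y}" by (rule edgeE)
      then show ?thesis
        using edge_boundary_component(1)[of x y v F] \<open>e \<in> E\<close> \<open>v \<in> V\<close> that by auto
    qed
    then show ?thesis by auto
  qed
  then have "(\<Sum>v\<in>V. real (card (edge_boundary V E (C F v))) * h v) =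
      (\<Sum>v\<in>V. \<Sum>e\<in>{e\<in>E - F. e \<in> edge_boundary V E (C F v)}. h v)"
    by (intro sum.cong refl) simp
  also have "\<dots> = (\<Sum>e\<in>E - F. \<Sum>v\<in>{v\<in>V. e \<in> edge_boundary V E (C F v)}. h v)"
    using finite_V finite_E by (intro sum.swap_restrict) auto
  finally show ?thesis .
qed

text \<open>With weight 1, a closed edge between components of sizes s and t is counted at most s +
  t times. This is at most 2 s t because s and t are at least 1, and 2 s t is its increment of
  \<open>X\<close> up to normalisation.\<close>

lemma merge_sum_ge:
  assumes "\<not> has_large_component V F c" "0 < c" "c < 1"
  shows "b * (1 - c) * X F \<le> merge_sum F"
proof -
  have "b * (1 - c) * (\<Sum>v\<in>V. sz F v) = (\<Sum>v\<in>V. b * (1 - c) * sz F v)"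
    by (rule sum_distrib_left)
  also have "\<dots> \<le> (\<Sum>v\<in>V. real (card (edge_boundary V E (C F v))) * 1)"
    using component_boundary_ge[OF _ assms] by (intro sum_mono) simp
  also have "\<dots> = (\<Sum>e\<in>E - F. \<Sum>v\<in>{v\<in>V. e \<in> edge_boundary V E (C F v)}. 1)"
    by (rule sum_boundary_swap)
  also have "\<dots> \<le> (\<Sum>e\<in>E - F. n\<^sup>2 * (X (insert e F) - X F))"
  proof (intro sum_mono)
    fix e assume e: "e \<in> E - F"
    then obtain x y where xy: "e = {x, y}" "x \<in> V" "y \<in> V" by (auto elim: edgeE)
    let ?A = "{v\<in>V. e \<in> edge_boundary V E (C F v)}"
    show "(\<Sum>v\<in>?A. 1) \<le> n\<^sup>2 * (X (insert e F) - X F)"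
    proof (cases "y \<in> C F x")
      case True
      then have "?A = {}" using edge_boundary_component(2)[of x y _ F] e xy by auto
      then show ?thesis
        using X_mono[OF subset_insertI, of F e] by (simp only: sum.empty) simp
    next
      case False
      have "?A \<subseteq> C F x \<union> C F y" using edge_boundary_component(3)[of x y _ F] e xy by auto
      then have "card ?A \<le> card (C F x \<union> C F y)" by (intro card_mono) (auto simp: finite_component)
      also have "\<dots> \<le> card (C F x) + card (C F y)" by (rule card_Un_le)
      finally have "(\<Sum>v\<in>?A. 1) \<le> sz F x + sz F y" by simp
      also have "\<dots> \<le> 2 * sz F x * sz F y"
      proof -
        have "0 \<le> (sz F x - 1) * sz F y + (sz F y - 1) * sz F x"
          using sz_ge_1[OF xy(2)] sz_ge_1[OF xy(3)] by (intro add_nonneg_nonneg mult_nonneg_nonneg) auto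
        then show ?thesis by (simp add: algebra_simps)
      qed
      also have "\<dots> = n\<^sup>2 * (X (insert e F) - X F)"
        using X_insert[OF xy(2,3), of F] False xy(1) n_pos by simp
      finally show ?thesis .
    qed
  qed
  also have "\<dots> = n\<^sup>2 * merge_sum F"
    by (simp add: merge_sum_def sum_distrib_left)
  finally show ?thesis
    using n_pos by (simp add: X_def field_simps)
qed

text \<open>With weight \<open>1 / sz F v\<close> every component has total weight 1, so each closed
  edge is counted at most twice.\<close>

lemma closed_edges_ge:
  assumes "\<not> has_large_component V F c" "0 < c" "c < 1"
  shows "b * (1 - c) * n \<le> 2 * real (card (E - F))"
proof -
  have "b * (1 - c) * n = (\<Sum>v\<in>V. b * (1 - c))" by simp
  also have "\<dots> \<le> (\<Sum>v\<in>V. real (card (edge_boundary V E (C F v))) * (1 / sz F v))"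
  proof (intro sum_mono)
    fix v assume v: "v \<in> V"
    show "b * (1 - c) \<le> real (card (edge_boundary V E (C F v))) * (1 / sz F v)"
      using component_boundary_ge[OF v assms] sz_ge_1[OF v, of F] by (simp add: field_simps)
  qed
  also have "\<dots> = (\<Sum>e\<in>E - F. \<Sum>v\<in>{v\<in>V. e \<in> edge_boundary V E (C F v)}. 1 / sz F v)"
    by (rule sum_boundary_swap)
  also have "\<dots> \<le> (\<Sum>e\<in>E - F. 2)"
  proof (intro sum_mono)
    fix e assume e: "e \<in> E - F"
    then obtain x y where xy: "e = {x, y}" "x \<in> V" "y \<in> V" by (auto elim: edgeE)
    let ?A = "{v\<in>V. e \<in> edge_boundary V E (C F v)}"
    have one: "(\<Sum>v\<in>C F z. 1 / sz F v) = 1" if "z \<in> V" for z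
    proof -
      have "(\<Sum>v\<in>C F z. 1 / sz F v) = (\<Sum>v\<in>C F z. 1 / sz F z)"
        by (intro sum.cong refl) (simp add: component_eq)
      then show ?thesis using sz_ge_1[OF that, of F] by simp
    qed
    have "?A \<subseteq> C F x \<union> C F y" using edge_boundary_component(3)[of x y _ F] e xy by auto
    then have "(\<Sum>v\<in>?A. 1 / sz F v) \<le> (\<Sum>v\<in>C F x \<union> C F y. 1 / sz F v)"
      by (intro sum_mono2) (auto simp: finite_component)
    also have "\<dots> \<le> (\<Sum>v\<in>C F x. 1 / sz F v) + (\<Sum>v\<in>C F y. 1 / sz F v)"
      by (subst sum.union_inter[symmetric]) (auto simp: finite_component sum_nonneg)
    finally show "(\<Sum>v\<in>?A. 1 / sz F v) \<le> 2"
      using one[OF xy(2)] one[OF xy(3)] by simp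
  qed
  finally show ?thesis by simp
qed

section \<open>Two big components are unlikely to coexist\<close>

text \<open>While the balls around \<open>T\<close> avoid \<open>S\<close>, each step adds at least
  b \<beta> n / d vertices. The condition on \<open>K\<close> makes \<open>K\<close> steps exceed
  n.\<close>

lemma near_hits:
  assumes "S \<subseteq> V" "T \<subseteq> V" "0 < \<beta>" "\<beta> * n \<le> real (card S)" "\<beta> * n \<le> real (card T)"
    and "real d < b * \<beta> * real K"
  shows "\<exists>s\<in>S. \<exists>t\<in>T. near K s t"
proof (rule ccontr)
  assume no: "\<not> ?thesis"
  define B where "B k = {v\<in>V. \<exists>t\<in>T. near k v t}" for k
  have B_sub: "B k \<subseteq> V" for k by (auto simp: B_def)
  have fin: "finite (B k)" for k using B_sub finite_V by (rule finite_subset)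
  have B_Suc: "B k \<subseteq> B (Suc k)" for k
    unfolding B_def using near_Suc by blast
  have B_mono: "B k \<subseteq> B K" if "k \<le> K" for k
    using that B_Suc by (rule lift_Suc_mono_le[rotated])
  have T_sub: "T \<subseteq> B k" for k
    using assms(2) by (cases k) (auto simp: B_def)
  \<comment> \<open>The ball contains \<open>T\<close> and its complement contains \<open>S\<close>,
    so its boundary has at least b \<beta> n edges. Their outer endpoints lie in the next ball and
    carry at most d edges each.\<close>
  have growth: "real (card (B k)) + b * \<beta> * n / d \<le> real (card (B (Suc k)))" if "k \<le> K" for k
  proof -
    have "S \<subseteq> V - B k"
      using no B_mono[OF that] assms(1) by (auto simp: B_def)
    then have "card S \<le> card (V - B k)"
      using finite_V by (intro card_mono) auto
    also have "\<dots> = card V - card (B k)"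
      using B_sub fin by (intro card_Diff_subset)
    finally have S: "\<beta> * n \<le> n - real (card (B k))"
      using assms(4) card_mono[OF finite_V B_sub[of k]] by linarith
    have T: "\<beta> * n \<le> real (card (B k))"
      using assms(5) card_mono[OF fin T_sub[of k]] by linarith
    let ?N = "B (Suc k) - B k"
    have "b * (\<beta> * n) \<le> real (card (edge_boundary V E (B k)))"
      using B_sub T S by (rule boundary_ge)
    also have "\<dots> \<le> real (card (\<Union>u\<in>?N. {e\<in>E. u \<in> e}))"
    proof -
      have "edge_boundary V E (B k) \<subseteq> (\<Union>u\<in>?N. {e\<in>E. u \<in> e})"
      proof
        fix e assume e: "e \<in> edge_boundary V E (B k)"
        then obtain u w where uw: "u \<in> e" "u \<in> V" "u \<notin> B k" "w \<in> e" "w \<in> B k" and eE: "e \<in> E"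
          by (auto simp: edge_boundary_def)
        from eE obtain x y where "e = {x, y}" by (rule edgeE)
        then have "e = {u, w}" using uw by auto
        then have "u \<in> B (Suc k)"
          using uw eE by (auto simp: B_def)
        then show "e \<in> (\<Union>u\<in>?N. {e\<in>E. u \<in> e})" using uw eE by auto
      qed
      then show ?thesis
        using fin finite_E by (intro of_nat_mono card_mono) auto
    qed
    also have "\<dots> \<le> real (card ?N * d)"
    proof -
      have "card (\<Union>u\<in>?N. {e\<in>E. u \<in> e}) \<le> (\<Sum>u\<in>?N. card {e\<in>E. u \<in> e})"
        using fin by (intro card_UN_le) auto
      also have "\<dots> \<le> (\<Sum>u\<in>?N. d)"
        using degree_le B_sub by (intro sum_mono) (auto simp: degree_def)
      finally show ?thesis by (intro of_nat_mono) simp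
    qed
    finally have "b * \<beta> * n / d \<le> real (card ?N)"
      using d_pos by (simp add: field_simps)
    moreover have "card ?N = card (B (Suc k)) - card (B k)"
      using B_Suc fin by (intro card_Diff_subset)
    moreover have "card (B k) \<le> card (B (Suc k))"
      using B_Suc fin by (intro card_mono)
    ultimately show ?thesis by linarith
  qed
  have "real k * (b * \<beta> * n / d) \<le> real (card (B k))" if "k \<le> K" for k
    using that
  proof (induction k)
    case (Suc k)
    then show ?case using growth[of k] by (simp only: of_nat_Suc distrib_right) simp
  qed simp
  then have "real K * (b * \<beta> * n / d) \<le> n"
    using card_mono[OF finite_V B_sub[of K]] by (meson le_refl of_nat_mono order.trans)
  then have "b * \<beta> * real K * n \<le> real d * n"
    using d_pos by (simp add: field_simps)
  then show False
    using assms(6) n_pos by simp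
qed

text \<open>The vertices of one big component that are not bridges are farther than \<open>K\<close>
  from the other, so by \<open>near_hits\<close> they number fewer than \<alpha> n / 2.\<close>

lemma two_big_bridges:
  assumes "two_big \<alpha> F" "0 < \<alpha>" "real d < b * (\<alpha> / 2) * real K"
  shows "\<alpha> / 2 * n \<le> (\<Sum>v\<in>V. of_bool (bridge \<alpha> K F v))"
proof -
  from assms obtain x y where xy: "x \<in> V" "y \<in> V" "y \<notin> C F x" "\<alpha> * n \<le> sz F x" "\<alpha> * n \<le> sz F y"
    by (auto simp: two_big_def)
  have disj: "C F x \<inter> C F y = {}"
    using xy by (intro component_disjoint)
  let ?S = "{v\<in>C F x. \<not> bridge \<alpha> K F v}" and ?B = "{v\<in>C F x. bridge \<alpha> K F v}"
  have "\<not> \<alpha> / 2 * n \<le> real (card ?S)"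
  proof
    assume S: "\<alpha> / 2 * n \<le> real (card ?S)"
    have "\<alpha> / 2 * n \<le> sz F y" using xy(5) n_pos assms(2) by (simp add: field_simps)
    then have "\<exists>s\<in>?S. \<exists>t\<in>C F y. near K s t"
      using S assms component_subset[of V F] by (intro near_hits[where \<beta> = "\<alpha> / 2"]) auto
    then obtain s t where st: "s \<in> C F x" "\<not> bridge \<alpha> K F s" "t \<in> C F y" "near K s t"
      by auto
    then have "bridge \<alpha> K F s"
      unfolding bridge_def
      using component_eq[OF st(1)] component_eq[OF st(3)] xy disj component_subset[of V F y] by auto
    then show False using st by simp
  qed
  moreover have "card (C F x) = card ?B + card ?S"
    by (subst card_Un_disjoint[symmetric]) (auto simp: finite_component intro: arg_cong[of _ _ card])
  ultimately have "\<alpha> / 2 * n \<le> real (card ?B)"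
    using xy(4) by linarith
  also have "\<dots> \<le> real (card {v\<in>V. bridge \<alpha> K F v})"
    using component_subset[of V F x] finite_V by (intro of_nat_mono card_mono) auto
  also have "\<dots> = (\<Sum>v\<in>V. of_bool (bridge \<alpha> K F v))"
    using finite_V by (simp add: Int_def)
  finally show ?thesis .
qed

text \<open>Iterating \<open>bridge_sum_le\<close> down to distance 0, where no bridge exists, gives
  a geometric sum; the lower bound \<open>a\<close> for \<open>p\<close> makes the constant uniform.
  The linear number of bridges supplies the factor n.\<close>

lemma two_big_prob_le:
  fixes a p :: real
  assumes "0 < a" "a \<le> p" "p \<le> 1" "0 < \<alpha>" "real d < b * (\<alpha> / 2) * real K"
  shows "expect E p (\<lambda>F. of_bool (two_big \<alpha> F)) * (\<alpha> / 2 * n) \<le>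
    2 * (\<Sum>i<K. (d * (1 + 1 / a)) ^ i) * expect E p (join_count \<alpha>)"
proof -
  define M where "M = d * (1 + 1 / a)"
  let ?s = "\<lambda>k. \<Sum>v\<in>V. expect E p (\<lambda>F. of_bool (bridge \<alpha> k F v))"
  let ?J = "expect E p (join_count \<alpha>)"
  have J: "0 \<le> ?J"
    using assms join_count_nonneg by (intro expect_nonneg) auto
  have bound: "?s k \<le> 2 * (\<Sum>i<k. M ^ i) * ?J" for k
  proof (induction k)
    case 0
    have "\<not> bridge \<alpha> 0 F v" if "v \<in> V" for F v
      using component_self[OF that] by (auto simp: bridge_def)
    then show ?case by (simp add: expect_def)
  next
    case (Suc k)
    have "?s (Suc k) \<le> d * (1 + 1 / p) * ?s k + 2 * ?J"
      using assms by (intro bridge_sum_le) auto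
    also have "\<dots> \<le> M * ?s k + 2 * ?J"
      unfolding M_def using assms
      by (intro add_right_mono mult_right_mono mult_left_mono add_left_mono divide_left_mono
          sum_nonneg expect_nonneg) auto
    also have "\<dots> \<le> M * (2 * (\<Sum>i<k. M ^ i) * ?J) + 2 * ?J"
      using Suc assms by (intro add_right_mono mult_left_mono) (auto simp: M_def)
    also have "\<dots> = 2 * (\<Sum>i<Suc k. M ^ i) * ?J"
      unfolding sum.lessThan_Suc_shift power_Suc sum_distrib_left[symmetric] by (simp add: algebra_simps)
    finally show ?case .
  qed
  have "expect E p (\<lambda>F. of_bool (two_big \<alpha> F)) * (\<alpha> / 2 * n) =
      expect E p (\<lambda>F. (\<alpha> / 2 * n) * of_bool (two_big \<alpha> F))"
    unfolding expect_cmult by (rule mult.commute)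
  also have "\<dots> \<le> expect E p (\<lambda>F. \<Sum>v\<in>V. of_bool (bridge \<alpha> K F v))"
  proof (intro expect_mono)
    fix F
    show "\<alpha> / 2 * n * of_bool (two_big \<alpha> F) \<le> (\<Sum>v\<in>V. of_bool (bridge \<alpha> K F v))"
      using two_big_bridges[of \<alpha> F K] assms by (cases "two_big \<alpha> F") (auto intro: sum_nonneg)
  qed (use assms in auto)
  also have "\<dots> = ?s K"
    by (rule expect_sum)
  also note bound[of K]
  finally show ?thesis by (simp add: M_def)
qed

section \<open>Concentration at good points and the sharp increase\<close>

text \<open>From E N \<le> L/(2 \<alpha>^2), two big components have probability at most Q
  L/(\<alpha>^3 n), and the product of the two bounds is the quantity in \<open>n2\<close>. Each
  square root in the variance bound is then at most \<gamma>^2 \<delta>/16, and Chebyshev gives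
  \<delta>/4.\<close>

lemma concentration:
  fixes a p :: real
  assumes "0 < a" "a \<le> p" "p \<le> 1" "0 < \<alpha>" "real d < b * (\<alpha> / 2) * real K"
    and Q_def: "Q = 2 * (\<Sum>i<K. (d * (1 + 1 / a)) ^ i)"
    and L: "expect E p merge_sum \<le> L" and "0 < \<gamma>" "0 < \<delta>"
    and \<alpha>_small: "sqrt (2 * \<alpha> * L) \<le> \<gamma>\<^sup>2 * \<delta> / 16"
    and n1: "Q * L / (\<alpha> ^ 3 * n) \<le> \<delta> / 4"
    and n2: "sqrt (Q * L\<^sup>2 / (2 * \<alpha> ^ 5 * n)) \<le> \<gamma>\<^sup>2 * \<delta> / 16"
  shows "expect E p (\<lambda>F. of_bool (two_big \<alpha> F)) \<le> \<delta> / 4"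
    and "expect E p (\<lambda>F. of_bool (\<gamma> \<le> \<bar>X F - expect E p X\<bar>)) \<le> \<delta> / 4"
proof -
  let ?P = "expect E p (\<lambda>F. of_bool (two_big \<alpha> F))" and ?J = "expect E p (join_count \<alpha>)"
  have p: "0 \<le> p" using assms by simp
  have J0: "0 \<le> ?J" and P0: "0 \<le> ?P" and L0: "0 \<le> expect E p merge_sum"
    using assms join_count_nonneg merge_sum_nonneg by (auto intro!: expect_nonneg)
  have Q0: "0 \<le> Q"
    unfolding Q_def using assms by (intro mult_nonneg_nonneg sum_nonneg) auto
  have "2 * \<alpha>\<^sup>2 * ?J = expect E p (\<lambda>F. 2 * \<alpha>\<^sup>2 * join_count \<alpha> F)"
    by (simp only: expect_cmult)
  also have "\<dots> \<le> expect E p merge_sum"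
    using assms join_count_le p by (intro expect_mono) auto
  finally have "2 * \<alpha>\<^sup>2 * ?J \<le> L" using L by linarith
  then have J: "?J \<le> L / (2 * \<alpha>\<^sup>2)"
    using assms(4) by (simp add: field_simps)
  have "?P * (\<alpha> / 2 * n) \<le> Q * ?J"
    unfolding Q_def using assms(1-5) by (rule two_big_prob_le)
  also have "\<dots> \<le> Q * (L / (2 * \<alpha>\<^sup>2))"
    using J Q0 by (rule mult_left_mono)
  finally have "?P * (\<alpha> / 2 * n) \<le> Q * (L / (2 * \<alpha>\<^sup>2))" .
  moreover have "Q * (L / (2 * \<alpha>\<^sup>2)) = Q * L / (\<alpha> ^ 3 * n) * (\<alpha> / 2 * n)"
    using assms(4) n_pos by (simp add: field_simps power2_eq_square power3_eq_cube)
  ultimately have "?P * (\<alpha> / 2 * n) \<le> Q * L / (\<alpha> ^ 3 * n) * (\<alpha> / 2 * n)"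
    by simp
  then have P: "?P \<le> Q * L / (\<alpha> ^ 3 * n)"
    using assms(4) n_pos by (intro mult_right_le_imp_le[of ?P "\<alpha> / 2 * n"]) auto
  then show "?P \<le> \<delta> / 4" using n1 by linarith
  have "?P * ?J \<le> Q * L / (\<alpha> ^ 3 * n) * (L / (2 * \<alpha>\<^sup>2))"
    using P J P0 J0 by (intro mult_mono) auto
  also have "\<dots> = Q * L\<^sup>2 / (2 * \<alpha> ^ 5 * n)"
    by (simp add: power2_eq_square power3_eq_cube numeral_eq_Suc field_simps)
  finally have "sqrt (?P * ?J) \<le> \<gamma>\<^sup>2 * \<delta> / 16"
    using n2 real_sqrt_le_mono order.trans by blast
  moreover have "sqrt (2 * \<alpha> * expect E p merge_sum) \<le> \<gamma>\<^sup>2 * \<delta> / 16"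
  proof -
    have "sqrt (2 * \<alpha> * expect E p merge_sum) \<le> sqrt (2 * \<alpha> * L)"
      using L assms(4) by simp
    then show ?thesis using \<alpha>_small by linarith
  qed
  ultimately have var: "expect E p (\<lambda>F. (X F - expect E p X)\<^sup>2) \<le> \<gamma>\<^sup>2 * (\<delta> / 4)"
  proof -
    have "v \<le> \<gamma>\<^sup>2 * (\<delta> / 4)" if "x \<le> \<gamma>\<^sup>2 * \<delta> / 16" "y \<le> \<gamma>\<^sup>2 * \<delta> / 16" "v \<le> 2 * (y + x)" for v x y
      using that by (simp add: field_simps)
    then show "sqrt (?P * ?J) \<le> \<gamma>\<^sup>2 * \<delta> / 16 \<Longrightarrow>
        sqrt (2 * \<alpha> * expect E p merge_sum) \<le> \<gamma>\<^sup>2 * \<delta> / 16 \<Longrightarrow> ?thesis"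
      using variance_X_le[OF p assms(3,4)] by blast
  qed
  have "expect E p (\<lambda>F. of_bool (\<gamma> \<le> \<bar>X F - expect E p X\<bar>)) \<le>
      expect E p (\<lambda>F. (X F - expect E p X)\<^sup>2) / \<gamma>\<^sup>2"
  proof (rule expect_Markov[where f = "\<lambda>F. (X F - expect E p X)\<^sup>2"])
    fix F assume "\<gamma> \<le> \<bar>X F - expect E p X\<bar>"
    then show "\<gamma>\<^sup>2 \<le> (X F - expect E p X)\<^sup>2"
      using \<open>0 < \<gamma>\<close> by (metis less_eq_real_def power2_abs power_mono)
  qed (use assms p in auto)
  also have "\<dots> \<le> \<delta> / 4"
    using var \<open>0 < \<gamma>\<close> by (simp add: field_simps)
  finally show "expect E p (\<lambda>F. of_bool (\<gamma> \<le> \<bar>X F - expect E p X\<bar>)) \<le> \<delta> / 4" .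
qed

text \<open>Good points \<open>t1\<close> and \<open>t2\<close> in the outer thirds pin E X near
  c^2, up to \<alpha> + 2 \<gamma>. The hypothesis \<open>small\<close> says that the growth forced
  over the middle third is at least this error.\<close>

lemma sharp_increase:
  fixes a p :: real
  assumes "0 < a" "a \<le> p" "p + \<epsilon> \<le> 1" "0 < \<epsilon>" "0 < c" "c < 1"
    and "0 < \<alpha>" "real d < b * (\<alpha> / 2) * real K"
    and Q_def: "Q = 2 * (\<Sum>i<K. (d * (1 + 1 / a)) ^ i)"
    and "0 < \<gamma>" "\<gamma> \<le> c\<^sup>2 / 4" "0 < \<delta>"
    and small: "\<alpha> + 2 * \<gamma> \<le> (\<epsilon> / 3) * (b * (1 - c) * (c\<^sup>2 / 2) * (\<delta> / 2))"
    and \<alpha>_small: "sqrt (2 * \<alpha> * (3 / \<epsilon>)) \<le> \<gamma>\<^sup>2 * \<delta> / 16"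
    and n1: "Q * (3 / \<epsilon>) / (\<alpha> ^ 3 * n) \<le> \<delta> / 4"
    and n2: "sqrt (Q * (3 / \<epsilon>)\<^sup>2 / (2 * \<alpha> ^ 5 * n)) \<le> \<gamma>\<^sup>2 * \<delta> / 16"
    and start: "\<delta> \<le> expect E p (\<lambda>F. of_bool (has_large_component V F c))"
  shows "1 - \<delta> \<le> expect E (p + \<epsilon>) (\<lambda>F. of_bool (has_large_component V F c))"
proof (rule ccontr)
  let ?A = "\<lambda>F. has_large_component V F c"
  let ?PA = "\<lambda>t. expect E t (\<lambda>F. of_bool (?A F))"
  let ?far = "\<lambda>t F. \<gamma> \<le> \<bar>X F - expect E t X\<bar>"
  define D where "D t = (\<Sum>e\<in>E. expect E t (\<lambda>F. X (insert e F) - X (F - {e})))" for t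
  assume "\<not> 1 - \<delta> \<le> ?PA (p + \<epsilon>)"
  then have end_p: "?PA (p + \<epsilon>) < 1 - \<delta>" by simp
  have PA_mono: "?PA s \<le> ?PA t" if "0 \<le> s" "s \<le> t" "t \<le> 1" for s t
    using that finite_E has_large_component_mono by (intro expect_mono_p) auto
  have lower: "\<delta> \<le> ?PA t" if "p \<le> t" "t \<le> p + \<epsilon>" for t
    using PA_mono[of p t] that start assms by simp
  have upper: "?PA t < 1 - \<delta>" if "p \<le> t" "t \<le> p + \<epsilon>" for t
    using PA_mono[of t "p + \<epsilon>"] that end_p assms by simp
  have deriv: "((\<lambda>t. expect E t X) has_real_derivative D t) (at t)" for t
    unfolding D_def by (rule Russo[OF finite_E])
  have merge_D: "expect E t merge_sum \<le> D t" if "p \<le> t" "t \<le> p + \<epsilon>" for t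
    unfolding merge_sum_def[abs_def] D_def
    using that assms X_mono finite_E by (intro expect_closed_sum_le_derivative) auto
  have X_range: "0 \<le> expect E t X \<and> expect E t X \<le> 1" if "0 \<le> t" "t \<le> 1" for t
    using expect_mono[OF that, of E X "\<lambda>_. 1"] X_le_1 X_nonneg that
    by (auto simp: expect_const finite_E intro!: expect_nonneg)
  \<comment> \<open>E X varies by at most 1 over a third of the interval, so the mean value theorem
    yields slope at most 3/\<epsilon> somewhere.\<close>
  have good: "\<exists>t. s < t \<and> t < s + \<epsilon> / 3 \<and> D t \<le> 3 / \<epsilon>" if s: "p \<le> s" "s + \<epsilon> / 3 \<le> p + \<epsilon>" for s
  proof -
    obtain t where t: "s < t" "t < s + \<epsilon> / 3"
      and eq: "expect E (s + \<epsilon> / 3) X - expect E s X = (s + \<epsilon> / 3 - s) * D t"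
      using MVT2[of s "s + \<epsilon> / 3" "\<lambda>t. expect E t X" D] deriv assms(4) by auto
    have "\<epsilon> / 3 * D t \<le> 1"
      using eq X_range[of s] X_range[of "s + \<epsilon> / 3"] s assms by auto
    then have "D t \<le> 3 / \<epsilon>" using assms(4) by (simp add: field_simps)
    then show ?thesis using t by blast
  qed
  have conc: "expect E t (\<lambda>F. of_bool (two_big \<alpha> F)) \<le> \<delta> / 4"
    "expect E t (\<lambda>F. of_bool (?far t F)) \<le> \<delta> / 4"
    if "p \<le> t" "t \<le> p + \<epsilon>" "D t \<le> 3 / \<epsilon>" for t
    by (rule concentration[of a t \<alpha> K Q "3 / \<epsilon>" \<gamma> \<delta>]; use that merge_D[of t] assms in linarith)+
  obtain t1 where t1: "p < t1" "t1 < p + \<epsilon> / 3" "D t1 \<le> 3 / \<epsilon>"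
    using good[of p] assms(4) by auto
  obtain t2 where t2: "p + 2 * \<epsilon> / 3 < t2" "t2 < p + \<epsilon>" "D t2 \<le> 3 / \<epsilon>"
    using good[of "p + 2 * \<epsilon> / 3"] assms(4) by auto
  \<comment> \<open>A large component has probability at least \<delta>, a deviation of
    \<open>X\<close> at most \<delta>/4, so some configuration has the first without the
    second.\<close>
  have m1: "c\<^sup>2 - \<gamma> < expect E t1 X"
  proof -
    have "expect E t1 (\<lambda>F. of_bool (?far t1 F)) < ?PA t1"
      using conc(2)[of t1] lower[of t1] t1 assms by linarith
    then obtain F where "(of_bool (?far t1 F) :: real) < of_bool (?A F)"
      by (rule expect_witness[rotated 2]) (use t1 assms in auto)
    then have "?A F" "\<not> ?far t1 F" by (auto simp: of_bool_def split: if_splits)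
    then show ?thesis using X_ge_if_large[of F c] assms by linarith
  qed
  \<comment> \<open>The three bad events have total probability below (1-\<delta>) + \<delta>/4 +
    \<delta>/4 < 1, so some configuration avoids them all.\<close>
  have m2: "expect E t2 X < c\<^sup>2 + \<alpha> + \<gamma>"
  proof -
    have "expect E t2 (\<lambda>F. of_bool (?A F) + of_bool (two_big \<alpha> F) + of_bool (?far t2 F)) < expect E t2 (\<lambda>_. 1)"
      using conc[of t2] upper[of t2] t2 assms by (simp add: expect_add expect_const finite_E)
    then obtain F where "of_bool (?A F) + of_bool (two_big \<alpha> F) + of_bool (?far t2 F) < (1::real)"
      by (rule expect_witness[rotated 2]) (use t2 assms in auto)
    then have "\<not> ?A F" "\<not> two_big \<alpha> F" "\<not> ?far t2 F" by (auto simp: of_bool_def split: if_splits)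
    then show ?thesis using X_le_if_not_large[of F c \<alpha>] assms by linarith
  qed
  define \<kappa> where "\<kappa> = b * (1 - c) * (c\<^sup>2 / 2)"
  have \<kappa>: "0 < \<kappa>" using assms b_pos by (simp add: \<kappa>_def)
  \<comment> \<open>At \<open>t1\<close>, \<open>X\<close> is at least c^2 - 2 \<gamma> \<ge> c^2/2
    except with probability \<delta>/4. This event is increasing, so the bound persists at
    \<open>t\<close>. A large component is absent with probability above \<delta>, and when both
    hold the Cheeger bound gives \<open>merge_sum\<close> at least \<kappa>.\<close>
  have D_ge: "\<kappa> * (\<delta> / 2) \<le> D t" if t: "t1 \<le> t" "t \<le> t2" for t
  proof -
    let ?PX = "\<lambda>t. expect E t (\<lambda>F. of_bool (c\<^sup>2 / 2 \<le> X F))"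
    have t01: "0 \<le> t" "t \<le> 1" using t t1 t2 assms by auto
    have "1 - \<delta> / 4 \<le> expect E t1 (\<lambda>F. 1 - of_bool (?far t1 F))"
      using conc(2)[of t1] t1 assms by (simp add: expect_diff expect_const finite_E)
    also have "\<dots> \<le> ?PX t1"
      using t1 m1 assms by (intro expect_mono) (auto simp: of_bool_def)
    also have "\<dots> \<le> ?PX t"
    proof (rule expect_mono_p[OF finite_E])
      fix F F' :: "'a set set" assume "F \<subseteq> F'"
      then show "of_bool (c\<^sup>2 / 2 \<le> X F) \<le> (of_bool (c\<^sup>2 / 2 \<le> X F') :: real)"
        using X_mono[of F F'] by (auto simp: of_bool_def)
    qed (use t t01 t1 assms in auto)
    finally have PX: "1 - \<delta> / 4 \<le> ?PX t" .
    have "\<kappa> * (\<delta> / 2) \<le> \<kappa> * (?PX t - ?PA t)"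
      using PX upper[of t] t t1 t2 \<kappa> assms by (intro mult_left_mono) auto
    also have "\<dots> = expect E t (\<lambda>F. \<kappa> * (of_bool (c\<^sup>2 / 2 \<le> X F) - of_bool (?A F)))"
      by (simp only: expect_cmult expect_diff)
    also have "\<dots> \<le> expect E t merge_sum"
    proof (intro expect_mono t01)
      fix F
      show "\<kappa> * (of_bool (c\<^sup>2 / 2 \<le> X F) - of_bool (?A F)) \<le> merge_sum F"
      proof (cases "c\<^sup>2 / 2 \<le> X F \<and> \<not> ?A F")
        case True
        then have "\<kappa> \<le> b * (1 - c) * X F"
          unfolding \<kappa>_def using assms b_pos by (intro mult_left_mono) auto
        also have "\<dots> \<le> merge_sum F" using True assms by (intro merge_sum_ge) auto
        finally show ?thesis using True by simp
      next
        case False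
        then have "\<kappa> * (of_bool (c\<^sup>2 / 2 \<le> X F) - of_bool (?A F)) \<le> 0"
          using \<kappa> by (auto simp: of_bool_def)
        then show ?thesis using merge_sum_nonneg[of F] by linarith
      qed
    qed
    also have "\<dots> \<le> D t" using t t1 t2 by (intro merge_D) auto
    finally show ?thesis .
  qed
  have t12: "t1 < t2" "\<epsilon> / 3 < t2 - t1" using t1 t2 assms(4) by auto
  obtain z where z: "t1 < z" "z < t2" "expect E t2 X - expect E t1 X = (t2 - t1) * D z"
    using MVT2[OF t12(1), of "\<lambda>t. expect E t X" D] deriv by auto
  have "(\<epsilon> / 3) * (\<kappa> * (\<delta> / 2)) \<le> (t2 - t1) * D z"
    using D_ge[of z] z t12 \<kappa> assms by (intro mult_mono) auto
  moreover have "(t2 - t1) * D z < \<alpha> + 2 * \<gamma>"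
    using m1 m2 z(3) by linarith
  ultimately show False
    using small unfolding \<kappa>_def by linarith
qed

lemma card_E_le: "real (card E) \<le> real d * n"
proof -
  have "2 * (\<Sum>e\<in>E. 1::real) = (\<Sum>v\<in>V. \<Sum>u\<in>{u. {v, u} \<in> E}. 1)"
    using sum_darts[of "\<lambda>_. 1"] by simp
  also have "\<dots> \<le> (\<Sum>v\<in>V. real d)"
    using card_neighbours by (intro sum_mono) simp
  finally have "2 * real (card E) \<le> real d * n" by (simp add: mult.commute)
  then show ?thesis by linarith
qed

section \<open>Retention probabilities near zero and one\<close>

text \<open>All vertices of a component with more than one vertex are endpoints of open edges, so a
  large component needs at least c n / 2 open edges; Markov's inequality bounds this.\<close>

lemma large_prob_small_p:
  fixes p c :: real
  assumes "0 \<le> p" "p \<le> 1" "0 < c" "1 < c * n"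
  shows "expect E p (\<lambda>F. of_bool (has_large_component V F c)) \<le> 2 * p * d / c"
proof -
  have "expect E p (\<lambda>F. of_bool (has_large_component V F c)) \<le> expect E p (\<lambda>F. real (card F)) / (c * n / 2)"
  proof (rule expect_Markov[where f = "\<lambda>F. real (card F)"])
    fix F assume F: "F \<subseteq> E" "has_large_component V F c"
    then obtain v where v: "v \<in> V" "c * n \<le> sz F v" by (auto simp: has_large_component_def)
    have finF: "finite F" using F finite_E finite_subset by blast
    have "C F v \<subseteq> \<Union>F"
    proof
      fix w assume w: "w \<in> C F v"
      have "C F w \<noteq> {w}"
        using component_eq[OF w] v(2) assms(4) by auto
      then obtain u where "conn F w u" "u \<noteq> w"
        using w component_self[of w V F] component_subset[of V F v] by (auto simp: component_conn)
      then obtain z where "{w, z} \<in> F"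
        unfolding conn_def by (cases rule: converse_rtranclpE) auto
      then show "w \<in> \<Union>F" by blast
    qed
    moreover have "finite (\<Union>F)"
      using F graph finite_V by (intro finite_subset[of "\<Union>F" V]) (auto simp: finite_graph_def)
    ultimately have "card (C F v) \<le> card (\<Union>F)" by (intro card_mono)
    also have "\<dots> \<le> sum card F"
      by (rule card_Union_le_sum_card)
    also have "\<dots> = (\<Sum>e\<in>F. 2)"
      using F graph by (intro sum.cong) (auto simp: finite_graph_def)
    finally show "c * n / 2 \<le> real (card F)" using v(2) by simp
  qed (use assms n_pos in auto)
  also have "\<dots> = p * real (card E) / (c * n / 2)"
    by (simp add: expect_card finite_E)
  also have "\<dots> \<le> p * (real d * n) / (c * n / 2)"
    using card_E_le assms n_pos by (intro divide_right_mono mult_left_mono) auto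
  also have "\<dots> = 2 * p * d / c"
    using n_pos by simp
  finally show ?thesis .
qed

text \<open>Without a large component linearly many edges are closed, by
  \<open>closed_edges_ge\<close>; Markov's inequality bounds this.\<close>

lemma large_prob_large_p:
  fixes p c :: real
  assumes "0 \<le> p" "p \<le> 1" "0 < c" "c < 1"
  shows "1 - 2 * (1 - p) * d / (b * (1 - c)) \<le> expect E p (\<lambda>F. of_bool (has_large_component V F c))"
proof -
  let ?k = "b * (1 - c) * n / 2"
  have k: "0 < ?k" using assms b_pos n_pos by simp
  have "expect E p (\<lambda>F. of_bool (\<not> has_large_component V F c)) \<le> expect E p (\<lambda>F. real (card (E - F))) / ?k"
  proof (rule expect_Markov[where f = "\<lambda>F. real (card (E - F))"])
    fix F assume "\<not> has_large_component V F c"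
    then show "?k \<le> real (card (E - F))" using closed_edges_ge[of F c] assms by simp
  qed (use assms k in auto)
  also have "\<dots> = (1 - p) * real (card E) / ?k"
    by (simp add: expect_card finite_E)
  also have "\<dots> \<le> (1 - p) * (real d * n) / ?k"
    using card_E_le assms k by (intro divide_right_mono mult_left_mono) auto
  also have "\<dots> = 2 * (1 - p) * d / (b * (1 - c))"
    using n_pos b_pos assms by (simp add: divide_simps)
  finally have "expect E p (\<lambda>F. of_bool (\<not> has_large_component V F c)) \<le> \<dots>" .
  moreover have "expect E p (\<lambda>F. of_bool (\<not> has_large_component V F c)) =
      1 - expect E p (\<lambda>F. of_bool (has_large_component V F c))"
    by (simp add: of_bool_not_iff expect_diff expect_const finite_E)
  ultimately show ?thesis by linarith
qed

end

section \<open>The threshold\<close>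

lemma eventually_divide_le:
  fixes A C :: real
  assumes "0 < C"
  shows "\<forall>\<^sub>F n in sequentially. A / real n \<le> C"
  using order_tendstoD(2)[OF lim_const_over_n assms, of A] by (auto elim: eventually_mono)

text \<open>The size \<open>N\<close> depends only on the numerical parameters, so one choice serves
  a whole sequence of graphs and all starting points \<open>p\<close>.\<close>

lemma sharp_threshold_uniform:
  fixes a \<epsilon> c \<delta> b :: real and d :: nat
  assumes "0 < a" "0 < \<epsilon>" "0 < c" "c < 1" "0 < \<delta>" "0 < b"
  shows "\<exists>N. \<forall>(V :: 'a set) E. expander_graph V E d b \<longrightarrow> N \<le> card V \<longrightarrow>
    (\<forall>p. a \<le> p \<longrightarrow> p + \<epsilon> \<le> 1 \<longrightarrow>
       \<delta> \<le> expect E p (\<lambda>F. of_bool (has_large_component V F c)) \<longrightarrow>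
       1 - \<delta> \<le> expect E (p + \<epsilon>) (\<lambda>F. of_bool (has_large_component V F c)))"
proof -
  \<comment> \<open>\<Delta> is the forced growth in \<open>small\<close>; taking \<gamma> and
    \<alpha> at most \<Delta>/8 leaves room for \<alpha> + 2 \<gamma>. The second bound on \<alpha>
    makes sqrt(2 \<alpha> L) at most \<open>s\<close>. Then \<open>K\<close> is chosen from
    \<alpha>, \<open>Q\<close> from \<open>K\<close>, and \<open>N\<close> last.\<close>
  define \<Delta> where "\<Delta> = (\<epsilon> / 3) * (b * (1 - c) * (c\<^sup>2 / 2) * (\<delta> / 2))"
  define \<gamma> where "\<gamma> = min (c\<^sup>2 / 4) (\<Delta> / 8)"
  define L where "L = 3 / \<epsilon>"
  define s where "s = \<gamma>\<^sup>2 * \<delta> / 16"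
  define \<alpha> where "\<alpha> = min (\<Delta> / 8) (s\<^sup>2 / (2 * L))"
  have \<Delta>: "0 < \<Delta>" unfolding \<Delta>_def using assms by simp
  have \<gamma>: "0 < \<gamma>" "\<gamma> \<le> c\<^sup>2 / 4" "\<gamma> \<le> \<Delta> / 8"
    unfolding \<gamma>_def using \<Delta> assms by auto
  have L: "0 < L" unfolding L_def using assms by simp
  have s: "0 < s" unfolding s_def using \<gamma> assms by simp
  have \<alpha>: "0 < \<alpha>" "\<alpha> \<le> \<Delta> / 8" "\<alpha> \<le> s\<^sup>2 / (2 * L)"
    unfolding \<alpha>_def using \<Delta> s L by auto
  have "2 * \<alpha> * L \<le> s\<^sup>2"
    using \<alpha>(3) L by (simp add: field_simps)
  then have \<alpha>_small: "sqrt (2 * \<alpha> * L) \<le> s"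
    using s by (intro real_le_lsqrt) auto
  obtain K :: nat where "real d < real K * (b * (\<alpha> / 2))"
    using \<alpha> assms ex_less_of_nat_mult[of "b * (\<alpha> / 2)"] by auto
  then have K: "real d < b * (\<alpha> / 2) * real K" by (simp add: mult_ac)
  define Q where "Q = 2 * (\<Sum>i<K. (d * (1 + 1 / a)) ^ i)"
  have "\<forall>\<^sub>F n in sequentially. Q * L / \<alpha> ^ 3 / real n \<le> \<delta> / 4 \<and> Q * L\<^sup>2 / (2 * \<alpha> ^ 5) / real n \<le> s\<^sup>2"
    using assms s by (intro eventually_conj eventually_divide_le) auto
  then obtain N where N: "\<And>n. N \<le> n \<Longrightarrow> Q * L / \<alpha> ^ 3 / real n \<le> \<delta> / 4"
    "\<And>n. N \<le> n \<Longrightarrow> Q * L\<^sup>2 / (2 * \<alpha> ^ 5) / real n \<le> s\<^sup>2"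
    by (auto simp: eventually_sequentially)
  show ?thesis
  proof (intro exI[of _ N] allI impI)
    fix V :: "'a set" and E p
    assume "expander_graph V E d b" and n: "N \<le> card V" and p: "a \<le> p" "p + \<epsilon> \<le> 1"
      and start: "\<delta> \<le> expect E p (\<lambda>F. of_bool (has_large_component V F c))"
    interpret expander_graph V E d b by fact
    have "sqrt (Q * L\<^sup>2 / (2 * \<alpha> ^ 5 * real (card V))) \<le> s"
      using N(2)[OF n] s by (intro real_le_lsqrt) auto
    moreover have "Q * L / (\<alpha> ^ 3 * real (card V)) \<le> \<delta> / 4"
      using N(1)[OF n] by simp
    moreover have "\<alpha> + 2 * \<gamma> \<le> \<Delta>" using \<alpha>(2) \<gamma>(3) \<Delta> by linarith
    ultimately show "1 - \<delta> \<le> expect E (p + \<epsilon>) (\<lambda>F. of_bool (has_large_component V F c))"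
      using assms p \<alpha>(1) K \<gamma>(1,2) \<alpha>_small start
      unfolding L_def s_def \<Delta>_def
      by (intro sharp_increase[of a p \<epsilon> c \<alpha> K Q \<gamma> \<delta>]) (auto simp: Q_def)
  qed
qed

theorem theorem1p3:
  fixes V :: "nat \<Rightarrow> 'a set" and E :: "nat \<Rightarrow> 'a set set" and c :: real
  assumes "expander V E"
    and "0 < c" and "c < 1"
  shows "\<exists>pstar :: nat \<Rightarrow> real.
           (\<exists>a a'. 0 < a \<and> a < a' \<and> a' < 1 \<and> (\<forall>n. a \<le> pstar n \<and> pstar n \<le> a')) \<and>
           (\<forall>\<epsilon>>0. \<forall>p :: nat \<Rightarrow> real. (\<forall>n. 0 \<le> p n \<and> p n \<le> 1) \<longrightarrow>
              ((\<forall>n. p n \<ge> pstar n + \<epsilon>) \<longrightarrow>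
                 (\<lambda>n. perc_prob (E n) (p n) (\<lambda>F. has_large_component (V n) F c)) \<longlonglongrightarrow> 1) \<and>
              ((\<forall>n. p n \<le> pstar n - \<epsilon>) \<longrightarrow>
                 (\<lambda>n. perc_prob (E n) (p n) (\<lambda>F. has_large_component (V n) F c)) \<longlonglongrightarrow> 0))"
proof -
  from assms(1) obtain b :: real and d :: nat where b: "0 < b" and d: "1 \<le> d"
    and graph: "\<And>n. finite_graph (V n) (E n)"
    and deg: "\<And>n v. v \<in> V n \<Longrightarrow> degree (E n) v \<le> d"
    and cheeger: "\<And>n. cheeger_gt (V n) (E n) b"
    and card: "filterlim (\<lambda>n. card (V n)) at_top sequentially"
    unfolding expander_def by blast
  define PA where "PA n p = expect (E n) p (\<lambda>F. of_bool (has_large_component (V n) F c))" for n p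
  have card_ev: "\<forall>\<^sub>F n in sequentially. N \<le> card (V n)" for N
    using card by (simp add: filterlim_at_top)
  \<comment> \<open>From \<open>N0\<close> on, c |V_n| exceeds 1, so the graph is nonempty and the
    locale applies; earlier graphs may be empty.\<close>
  have "\<forall>\<^sub>F n in sequentially. nat \<lceil>1 / c\<rceil> + 1 \<le> card (V n)"
    by (rule card_ev)
  then obtain N0 where N0: "\<And>n. N0 \<le> n \<Longrightarrow> nat \<lceil>1 / c\<rceil> + 1 \<le> card (V n)"
    by (auto simp: eventually_sequentially)
  have large: "1 < c * real (card (V n))" if "N0 \<le> n" for n
  proof -
    have "1 / c < real (card (V n))" using N0[OF that] by linarith
    then show ?thesis using assms(2) by (simp add: field_simps)
  qed
  have eg: "expander_graph (V n) (E n) d b" if "N0 \<le> n" for n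
    using large[OF that] graph deg cheeger b d by unfold_locales auto
  have finE: "finite (E n)" for n
    using graph[of n] by (intro finite_subset[of "E n" "Pow (V n)"]) (auto simp: finite_graph_def)
  have perc: "perc_prob (E n) p (\<lambda>F. has_large_component (V n) F c) = PA n p" for n p
    unfolding PA_def by (rule perc_prob_expect[OF finE])
  have PA_mono: "PA n p \<le> PA n q" if "N0 \<le> n" "0 \<le> p" "p \<le> q" "q \<le> 1" for n p q
  proof -
    interpret expander_graph "V n" "E n" d b by (rule eg) fact
    show ?thesis
      unfolding PA_def using that has_large_component_mono finE by (intro expect_mono_p) auto
  qed
  have PA_range: "0 \<le> PA n p" "PA n p \<le> 1" if "0 \<le> p" "p \<le> 1" for n p
    using that expect_mono[OF that, of "E n" "\<lambda>F. of_bool (has_large_component (V n) F c)" "\<lambda>_. 1"]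
    by (auto simp: PA_def expect_const finE intro!: expect_nonneg)
  \<comment> \<open>The factor 8 makes both extreme bounds at most 1/4, so the probability is below
    1/2 at \<open>a\<close> and above 1/2 at \<open>a'\<close>. The cap 1/4 keeps \<open>a\<close>
    below \<open>a'\<close>.\<close>
  define a where "a = min (1 / 4) (c / (8 * d))"
  define a' where "a' = 1 - min (1 / 4) (b * (1 - c) / (8 * d))"
  have a: "0 < a" "a \<le> 1 / 4" "a \<le> c / (8 * d)"
    unfolding a_def using assms d by auto
  have a': "3 / 4 \<le> a'" "a' < 1" "1 - a' \<le> b * (1 - c) / (8 * d)"
    unfolding a'_def using assms b d by auto
  \<comment> \<open>The threshold is a median, given by continuity in p. Before \<open>N0\<close>
    any value in the range serves, as limits ignore these indices.\<close>
  have "\<exists>x. a \<le> x \<and> x \<le> a' \<and> (N0 \<le> n \<longrightarrow> PA n x = 1 / 2)" for n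
  proof (cases "N0 \<le> n")
    case True
    interpret expander_graph "V n" "E n" d b by (rule eg) fact
    have "PA n a \<le> 2 * a * d / c"
      unfolding PA_def using a assms large[OF True] by (intro large_prob_small_p) auto
    also have "\<dots> \<le> 1 / 2"
      using a(3) assms d by (simp add: field_simps)
    finally have lo: "PA n a \<le> 1 / 2" .
    have "2 * (1 - a') * d / (b * (1 - c)) \<le> 1 / 2"
    proof -
      have "0 < b * (1 - c)" using assms b by simp
      moreover have "8 * ((1 - a') * d) \<le> b * (1 - c)"
        using a'(3) d by (simp add: pos_le_divide_eq mult_ac)
      ultimately have "0 < b * (1 - c)" "2 * ((1 - a') * d) \<le> 1 / 2 * (b * (1 - c))"
        by linarith+
      then show ?thesis
        unfolding mult.assoc[of 2] by (simp only: pos_divide_le_eq)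
    qed
    moreover have "1 - 2 * (1 - a') * d / (b * (1 - c)) \<le> PA n a'"
      unfolding PA_def using a' assms by (intro large_prob_large_p) auto
    ultimately have hi: "1 / 2 \<le> PA n a'" by linarith
    have "isCont (PA n) x" for x
      unfolding PA_def[abs_def] using Russo[OF finE] by (rule DERIV_isCont)
    then have "\<exists>x\<ge>a. x \<le> a' \<and> PA n x = 1 / 2"
      using lo hi a a' by (intro IVT) auto
    then show ?thesis by auto
  next
    case False
    then show ?thesis using a a' by (intro exI[of _ a]) auto
  qed
  then obtain pstar where pstar: "\<And>n. a \<le> pstar n" "\<And>n. pstar n \<le> a'"
    "\<And>n. N0 \<le> n \<Longrightarrow> PA n (pstar n) = 1 / 2"
    by metis
  \<comment> \<open>The lower end \<open>a / 2\<close>, rather than \<open>a\<close>, admits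
    starting points a little below \<open>pstar n\<close>.\<close>
  have sharp: "\<forall>\<^sub>F n in sequentially. N0 \<le> n \<and> (\<forall>q. a / 2 \<le> q \<longrightarrow> q + \<epsilon> \<le> 1 \<longrightarrow>
      \<delta> \<le> PA n q \<longrightarrow> 1 - \<delta> \<le> PA n (q + \<epsilon>))" if pos: "0 < \<epsilon>" "0 < \<delta>" for \<epsilon> \<delta>
  proof -
    obtain N where N: "\<forall>(V :: 'a set) E. expander_graph V E d b \<longrightarrow> N \<le> card V \<longrightarrow>
      (\<forall>p. a / 2 \<le> p \<longrightarrow> p + \<epsilon> \<le> 1 \<longrightarrow>
         \<delta> \<le> expect E p (\<lambda>F. of_bool (has_large_component V F c)) \<longrightarrow>
         1 - \<delta> \<le> expect E (p + \<epsilon>) (\<lambda>F. of_bool (has_large_component V F c)))"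
      using sharp_threshold_uniform[OF half_gt_zero[OF a(1)] pos(1) assms(2,3) pos(2) b, where d = d]
      by blast
    show ?thesis
      using eventually_ge_at_top[of N0] card_ev[of N]
    proof eventually_elim
      case (elim n)
      then show ?case using N eg[of n] by (auto simp: PA_def)
    qed
  qed
  have above: "(\<lambda>n. PA n (p n)) \<longlonglongrightarrow> 1"
    if "0 < \<epsilon>" and p: "\<And>n. 0 \<le> p n \<and> p n \<le> 1" "\<And>n. pstar n + \<epsilon> \<le> p n" for \<epsilon> p
  proof (rule order_tendstoI)
    fix l :: real assume "l < 1"
    define \<delta> where "\<delta> = min (1 / 2) ((1 - l) / 2)"
    have \<delta>: "0 < \<delta>" "\<delta> \<le> 1 / 2" "\<delta> < 1 - l"
      using \<open>l < 1\<close> by (auto simp: \<delta>_def min_def)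
    show "\<forall>\<^sub>F n in sequentially. l < PA n (p n)"
      using sharp[OF \<open>0 < \<epsilon>\<close> \<delta>(1)]
    proof eventually_elim
      case (elim n)
      \<comment> \<open>One step of length \<epsilon> from the median, where the probability 1/2 is
        at least \<delta>.\<close>
      have "1 - \<delta> \<le> PA n (pstar n + \<epsilon>)"
        using elim \<delta> pstar(1)[of n] pstar(3)[of n] a p(1)[of n] p(2)[of n] by auto
      also have "\<dots> \<le> PA n (p n)"
        using elim p(1)[of n] p(2)[of n] pstar(1)[of n] a that(1) by (intro PA_mono) auto
      finally show ?case using \<delta> by linarith
    qed
  next
    fix u :: real assume "1 < u"
    then show "\<forall>\<^sub>F n in sequentially. PA n (p n) < u"
      using PA_range(2) p(1) by (intro always_eventually allI) (meson le_less_trans)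
  qed
  have below: "(\<lambda>n. PA n (p n)) \<longlonglongrightarrow> 0"
    if "0 < \<epsilon>" and p: "\<And>n. 0 \<le> p n \<and> p n \<le> 1" "\<And>n. p n \<le> pstar n - \<epsilon>" for \<epsilon> p
  proof (rule order_tendstoI)
    fix u :: real assume "0 < u"
    define \<delta> where "\<delta> = min (1 / 4) u"
    have \<delta>: "0 < \<delta>" "\<delta> < 1 / 2" "\<delta> \<le> u"
      using \<open>0 < u\<close> by (auto simp: \<delta>_def)
    \<comment> \<open>The cap a/2 keeps the starting point \<open>pstar n - \<epsilon>'\<close> at
      least a/2; monotonicity covers the remaining distance.\<close>
    define \<epsilon>' where "\<epsilon>' = min \<epsilon> (a / 2)"
    have \<epsilon>': "0 < \<epsilon>'" "\<epsilon>' \<le> \<epsilon>" "\<epsilon>' \<le> a / 2"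
      using that(1) a by (auto simp: \<epsilon>'_def)
    show "\<forall>\<^sub>F n in sequentially. PA n (p n) < u"
      using sharp[OF \<epsilon>'(1) \<delta>(1)]
    proof eventually_elim
      case (elim n)
      let ?q = "pstar n - \<epsilon>'"
      have q: "a / 2 \<le> ?q" "?q + \<epsilon>' \<le> 1"
        using pstar(1,2)[of n] \<epsilon>' a' by linarith+
      \<comment> \<open>Otherwise a step of length \<epsilon>' would give probability at least
        1-\<delta> > 1/2 at the median.\<close>
      have "\<not> \<delta> \<le> PA n ?q"
      proof
        assume "\<delta> \<le> PA n ?q"
        then have "1 - \<delta> \<le> PA n (?q + \<epsilon>')" using elim q by blast
        then show False using pstar(3)[of n] elim \<delta> by simp
      qed
      moreover have "PA n (p n) \<le> PA n ?q"
        using elim p(1)[of n] p(2)[of n] \<epsilon>' q by (intro PA_mono) auto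
      ultimately show ?case using \<delta> by linarith
    qed
  next
    fix l :: real assume "l < 0"
    then show "\<forall>\<^sub>F n in sequentially. l < PA n (p n)"
      using PA_range(1) p(1) by (intro always_eventually allI) (meson less_le_trans)
  qed
  show ?thesis
    unfolding perc
  proof (intro exI[of _ pstar] conjI allI impI)
    show "\<exists>a a'. 0 < a \<and> a < a' \<and> a' < 1 \<and> (\<forall>n. a \<le> pstar n \<and> pstar n \<le> a')"
      using a a' pstar by (intro exI[of _ a] exI[of _ a']) auto
  qed (use above below in blast)+
qed

end
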